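(* Let $n\ge 2$, let $G$ be a relation graph, let $T(L)$ be a $G$-realization, and let $T(R)\in\mathcal{B}_G(T(L))$. Then the subquotient $M(T(R))$ of $V_G(T(L))$ (the subquotient containing $T(R)$) is a simple $U(\mathfrak{gl}(n))$-module, and a basis of it is given by (the images of the distinct elements of) $$\mathcal{I}_G(T(R)):=\{\,T(S)\in\mathcal{B}_G(T(L)) \mid E^+_{G(R)}=E^+_{G(S)}\,\}.$$
   Context: Fix $n\ge2$. $\mathfrak{gl}(n)$ is the Lie algebra of $n\times n$ complex matrices with matrix units $E_{ij}$, and $U=U(\mathfrak{gl}(n))$ is its universal enveloping algebra. Let $\mathfrak{V}=\{(i,j) : 1\le j\le i\le n\}$; the vertices $(k,1),\dots,(k,k)$ form row $k$, and row $n$ is the top row (row $k+1$ is drawn above row $k$). All graphs are directed graphs with vertex set $\mathfrak{V}$. Tableaux. For $L=(l_{ij})_{(i,j)\in\mathfrak{V}}\in\mathbb{C}^{n(n+1)/2}$, $T(L)$ denotes the Gelfand--Tsetlin tableau with entry $l_{ij}$ at position $(i,j)$. Let $\delta^{ki}$ be the vector with entry $1$ at position $(k,i)$ and $0$ elsewhere. Let $\mathbb{Z}_0^{n(n+1)/2}$ be the set of $w\in\mathbb{Z}^{n(n+1)/2}$ with $w_{n,i}=0$ for all $1\le i\le n$. Relation graphs. For $1\le i<j\le k\le n-1$, $((k,i),(k,j))$ is an adjoining pair of vertices in $G$ if there is a directed path in $G$ from $(k,i)$ to $(k,j)$ and, whenever $i<t<j$, there are no directed paths from $(k,i)$ to $(k,t)$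 or from $(k,t)$ to $(k,j)$. $G$ is a relation graph if: (i) the only possible arrows of $G$ connect vertices in consecutive rows or vertices in the $n$-th row; (ii) for $1\le k\le n$ and $1\le i<j\le k$ there is no directed path from $(k,j)$ to $(k,i)$; (iii) $G$ has no oriented cycles and no multiple arrows; (iv) for any two vertices in the same row $k<n$ and in the same connected component of the unoriented graph associated to $G$, there is an oriented path in $G$ from one of them to the other; (v) $G$ does not contain a subgraph consisting of two arrows $(k+1,r)\to(k,j)$ and $(k+1,s)\to(k,i)$ with $1\le r<s\le k+1$ and $1\le i<j\le k$; (vi) for every adjoining pair $((k,i),(k,j))$, $G$ contains either the four arrows $(k,i)\to(k+1,p)$, $(k+1,p)\to(k,j)$, $(k,i)\to(k-1,q)$, $(k-1,q)\to(k,j)$ for some $1\le p\le k+1$, $1\le q\le k-1$, or the two arrows $(k,i)\to(k+1,s)$, $(k+1,t)\to(k,j)$ for some $1\le s<t\le k+1$. Realizations. $T(L)$ satisfies $G$ if for every arrow of $G$ from $(i,j)$ to $(r,s)$: $l_{ij}-l_{rs}\in\mathbb{Z}_{\ge0}$ if the arrow is horizontal or points down (i.e. $i=r$ or $i=r+1$), and $l_{ij}-l_{rs}\in\mathbb{Z}_{>0}$ if the arrow points up ($i=r-1$). $T(L)$ is a $G$-realization if it satisfies $G$ and, for every $1\le k\le n-1$, $l_{ki}-l_{kj}\in\mathbb{Z}$ only if $(k,i)$ and $(k,j)$ are in the same connected component of the unoriented graph associated to $G$. For a $G$-realization $T(L)$, $\mathcal{B}_G(T(L))$ is the set of all $G$-realizations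 of the form $T(L+z)$ with $z\in\mathbb{Z}_0^{n(n+1)/2}$. The module. For a relation graph $G$ and a $G$-realization $T(L)$, $V_G(T(L))$ is the complex vector space with basis $\mathcal{B}_G(T(L))$. It is a known theorem that it is a $\mathfrak{gl}(n)$-module under the Gelfand--Tsetlin formulas $$E_{k,k+1}T(L)=-\sum_{i=1}^{k}\frac{\prod_{j=1}^{k+1}(l_{ki}-l_{k+1,j})}{\prod_{j\ne i}(l_{ki}-l_{kj})}T(L+\delta^{ki}),\qquad E_{k+1,k}T(L)=\sum_{i=1}^{k}\frac{\prod_{j=1}^{k-1}(l_{ki}-l_{k-1,j})}{\prod_{j\ne i}(l_{ki}-l_{kj})}T(L-\delta^{ki}),$$ $$E_{kk}T(L)=\Bigl(k-1+\sum_{i=1}^{k}l_{ki}-\sum_{i=1}^{k-1}l_{k-1,i}\Bigr)T(L)$$ (applied to every basis tableau; the products over $j\neq i$ run over $1\le j\le k$; terms whose tableau is not in $\mathcal{B}_G(T(L))$ are zero). The graph $G(L)$. For any tableau $T(L)$, $G(L)$ is the graph with vertex set $\mathfrak{V}$ and an arrow from $(i,j)$ to $(r,s)$ if: $i=r+1$ and $l_{ij}-l_{rs}\in\mathbb{Z}_{\ge0}$; or $i=r-1$ and $l_{ij}-l_{rs}\in\mathbb{Z}_{>0}$; or $i=r=n$, $j<s$ and $l_{ij}-l_{rs}\in\mathbb{Z}_{\ge0}$. For a graph $H$, $E_H^+$ is the set of arrows of $H$ pointing down, i.e. from a vertex of row $k$ to a vertex of row $k-1$. The subquotient containing $T(R)$.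 For $T(R)\in\mathcal{B}_G(T(L))$, $$M(T(R)):=U\cdot T(R)\Big/\sum U\cdot T(Q),$$ where the sum is over all tableaux $T(Q)\in\mathcal{B}_G(T(L))$ such that $T(Q)\in U\cdot T(R)$ and $U\cdot T(Q)$ is a proper submodule of $U\cdot T(R)$.
   Formalization: That M(T(R)) satisfies the gl(n) bracket relations is claimed only when V_G(T(L)) is a gl(n)-module; this quoted fact can fail for unordered top-row entries. Simplicity (no proper nonzero subspace stable under all E_ij) and the basis are claimed always. *)

theory Defs
  imports "Jordan_Normal_Form.VS_Connect" "HOL-Algebra.QuotRing" "HOL-Library.Poly_Mapping"
begin

section \<open>Modules over $\mathfrak{gl}(n)$\<close>

text \<open>
  A complex vector space (in the sense of \<^locale>\<open>vectorspace\<close>, over the field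
  \<^term>\<open>class_ring :: complex ring\<close>) with operators \<open>act i j\<close>, the action of the matrix
  units \<open>E\<^sub>i\<^sub>j\<close>. The ring multiplication of the underlying record plays no role.
\<close>

record 'v gl_rep = "(complex, 'v) module" +
  act :: "nat \<Rightarrow> nat \<Rightarrow> 'v \<Rightarrow> 'v"

definition gl_action :: "nat \<Rightarrow> ('v, 'm) gl_rep_scheme \<Rightarrow> bool" where
  "gl_action n M \<longleftrightarrow> vectorspace class_ring M \<and>
     (\<forall>i\<in>{1..n}. \<forall>j\<in>{1..n}. linear_map class_ring M M (act M i j))"

text \<open>A $U(\mathfrak{gl}(n))$-module is the same thing as a $\mathfrak{gl}(n)$-module:\<close>

definition gl_module :: "nat \<Rightarrow> ('v, 'm) gl_rep_scheme \<Rightarrow> bool" where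
  "gl_module n M \<longleftrightarrow> gl_action n M \<and>
     (\<forall>i\<in>{1..n}. \<forall>j\<in>{1..n}. \<forall>k\<in>{1..n}. \<forall>l\<in>{1..n}. \<forall>v\<in>carrier M.
        act M i j (act M k l v) \<ominus>\<^bsub>M\<^esub> act M k l (act M i j v) =
        (if j = k then act M i l v else \<zero>\<^bsub>M\<^esub>) \<ominus>\<^bsub>M\<^esub> (if l = i then act M k j v else \<zero>\<^bsub>M\<^esub>))"

definition gl_submodule :: "nat \<Rightarrow> 'v set \<Rightarrow> ('v, 'm) gl_rep_scheme \<Rightarrow> bool" where
  "gl_submodule n W M \<longleftrightarrow> VectorSpace.subspace class_ring W M \<and>
     (\<forall>i\<in>{1..n}. \<forall>j\<in>{1..n}. \<forall>v\<in>W. act M i j v \<in> W)"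

text \<open>
  Simplicity only concerns the subspaces stable under the matrix units. That the operators satisfy
  the bracket relations is kept apart as \<^const>\<open>gl_module\<close>, because it is a property that a
  subquotient inherits from the ambient module.
\<close>

definition simple_gl :: "nat \<Rightarrow> ('v, 'm) gl_rep_scheme \<Rightarrow> bool" where
  "simple_gl n M \<longleftrightarrow> gl_action n M \<and> carrier M \<noteq> {\<zero>\<^bsub>M\<^esub>} \<and>
     (\<forall>W. gl_submodule n W M \<longrightarrow> W = {\<zero>\<^bsub>M\<^esub>} \<or> W = carrier M)"

text \<open>
  The image of $U(\mathfrak{gl}(n))$ in the operators on \<open>M\<close>: $U(\mathfrak{gl}(n))$ is generated,
  as a unital associative algebra, by the matrix units.
\<close>

inductive_set U_image :: "nat \<Rightarrow> ('v, 'm) gl_rep_scheme \<Rightarrow> ('v \<Rightarrow> 'v) set"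
  for n :: nat and M :: "('v, 'm) gl_rep_scheme" where
  one: "(\<lambda>v. v) \<in> U_image n M"
| unit: "i \<in> {1..n} \<Longrightarrow> j \<in> {1..n} \<Longrightarrow> act M i j \<in> U_image n M"
| add: "X \<in> U_image n M \<Longrightarrow> Y \<in> U_image n M \<Longrightarrow> (\<lambda>v. X v \<oplus>\<^bsub>M\<^esub> Y v) \<in> U_image n M"
| smult: "X \<in> U_image n M \<Longrightarrow> (\<lambda>v. c \<odot>\<^bsub>M\<^esub> X v) \<in> U_image n M"
| mult: "X \<in> U_image n M \<Longrightarrow> Y \<in> U_image n M \<Longrightarrow> (\<lambda>v. X (Y v)) \<in> U_image n M"

definition U_orbit :: "nat \<Rightarrow> ('v, 'm) gl_rep_scheme \<Rightarrow> 'v \<Rightarrow> 'v set" where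
  "U_orbit n M v = {X v |X. X \<in> U_image n M}"

definition sum_of_submodules :: "('v, 'm) gl_rep_scheme \<Rightarrow> 'i set \<Rightarrow> ('i \<Rightarrow> 'v set) \<Rightarrow> 'v set" where
  "sum_of_submodules M I W =
     {finsum M w F |w F. finite F \<and> F \<subseteq> I \<and> (\<forall>q\<in>F. w q \<in> W q)}"

text \<open>The operations on cosets are formed as in \<^const>\<open>rcoset_mult\<close>.\<close>

definition quotient_rep :: "('v, 'm) gl_rep_scheme \<Rightarrow> 'v set \<Rightarrow> 'v set gl_rep" where
  "quotient_rep M N =
     \<lparr> carrier = a_rcosets\<^bsub>M\<^esub> N, mult = undefined, one = undefined,
       zero = N, add = set_add M,
       smult = (\<lambda>c A. \<Union>v\<in>A. N +>\<^bsub>M\<^esub> (c \<odot>\<^bsub>M\<^esub> v)),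
       act = (\<lambda>i j A. \<Union>v\<in>A. N +>\<^bsub>M\<^esub> (act M i j v)) \<rparr>"

section \<open>Relation graphs\<close>

text \<open>A graph is its set of arrows, so multiple arrows are excluded by construction.\<close>

type_synonym vertex = "nat \<times> nat"
type_synonym graph = "(vertex \<times> vertex) set"

definition vertices :: "nat \<Rightarrow> vertex set" where
  "vertices n = {(i, j). 1 \<le> j \<and> j \<le> i \<and> i \<le> n}"

definition same_component :: "graph \<Rightarrow> vertex \<Rightarrow> vertex \<Rightarrow> bool" where
  "same_component G a b \<longleftrightarrow> (a, b) \<in> (G \<union> G\<inverse>)\<^sup>*"

definition adjoining :: "nat \<Rightarrow> graph \<Rightarrow> nat \<Rightarrow> nat \<Rightarrow> nat \<Rightarrow> bool" where
  "adjoining n G k i j \<longleftrightarrow>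
     1 \<le> i \<and> i < j \<and> j \<le> k \<and> k \<le> n - 1 \<and> ((k, i), (k, j)) \<in> G\<^sup>+ \<and>
     (\<forall>t. i < t \<and> t < j \<longrightarrow> ((k, i), (k, t)) \<notin> G\<^sup>+ \<and> ((k, t), (k, j)) \<notin> G\<^sup>+)"

definition relation_graph :: "nat \<Rightarrow> graph \<Rightarrow> bool" where
  "relation_graph n G \<longleftrightarrow>
     G \<subseteq> vertices n \<times> vertices n \<and>
     (\<forall>((i, j), (r, s))\<in>G. i = r + 1 \<or> r = i + 1 \<or> (i = n \<and> r = n)) \<and>
     (\<forall>k i j. k \<le> n \<and> 1 \<le> i \<and> i < j \<and> j \<le> k \<longrightarrow> ((k, j), (k, i)) \<notin> G\<^sup>+) \<and>
     acyclic G \<and>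
     (\<forall>k i j. 1 \<le> k \<and> k < n \<and> i \<in> {1..k} \<and> j \<in> {1..k} \<and> same_component G (k, i) (k, j) \<longrightarrow>
        ((k, i), (k, j)) \<in> G\<^sup>* \<or> ((k, j), (k, i)) \<in> G\<^sup>*) \<and>
     \<not> (\<exists>k r s i j. 1 \<le> r \<and> r < s \<and> s \<le> k + 1 \<and> 1 \<le> i \<and> i < j \<and> j \<le> k \<and>
          ((k + 1, r), (k, j)) \<in> G \<and> ((k + 1, s), (k, i)) \<in> G) \<and>
     (\<forall>k i j. adjoining n G k i j \<longrightarrow>
        (\<exists>p\<in>{1..k + 1}. \<exists>q\<in>{1..k - 1}.
           ((k, i), (k + 1, p)) \<in> G \<and> ((k + 1, p), (k, j)) \<in> G \<and>
           ((k, i), (k - 1, q)) \<in> G \<and> ((k - 1, q), (k, j)) \<in> G) \<or>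
        (\<exists>s t. 1 \<le> s \<and> s < t \<and> t \<le> k + 1 \<and>
           ((k, i), (k + 1, s)) \<in> G \<and> ((k + 1, t), (k, j)) \<in> G))"

section \<open>Tableaux and realizations\<close>

text \<open>
  Only the entries at \<^term>\<open>vertices n\<close> are relevant. Entries elsewhere are arbitrary but are never
  changed, so that all elements of \<open>basis_tableaux n G L\<close> below agree there.
\<close>

type_synonym tableau = "vertex \<Rightarrow> complex"

definition satisfies :: "graph \<Rightarrow> tableau \<Rightarrow> bool" where
  "satisfies G L \<longleftrightarrow>
     (\<forall>((i, j), (r, s))\<in>G.
        (i = r \<or> i = r + 1 \<longrightarrow> L (i, j) - L (r, s) \<in> \<nat>) \<and>
        (r = i + 1 \<longrightarrow> L (i, j) - L (r, s) \<in> \<nat> - {0}))"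

definition realization :: "nat \<Rightarrow> graph \<Rightarrow> tableau \<Rightarrow> bool" where
  "realization n G L \<longleftrightarrow> satisfies G L \<and>
     (\<forall>k\<in>{1..n - 1}. \<forall>i\<in>{1..k}. \<forall>j\<in>{1..k}.
        L (k, i) - L (k, j) \<in> \<int> \<longrightarrow> same_component G (k, i) (k, j))"

definition int_shifts :: "nat \<Rightarrow> (vertex \<Rightarrow> int) set" where
  "int_shifts n = {z. (\<forall>p. p \<notin> vertices n \<longrightarrow> z p = 0) \<and> (\<forall>i. z (n, i) = 0)}"

definition basis_tableaux :: "nat \<Rightarrow> graph \<Rightarrow> tableau \<Rightarrow> tableau set" where
  "basis_tableaux n G L =
     {S. (\<exists>z\<in>int_shifts n. S = (\<lambda>p. L p + of_int (z p))) \<and> realization n G S}"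

definition graph_of :: "nat \<Rightarrow> tableau \<Rightarrow> graph" where
  "graph_of n L =
     {((i, j), (r, s)). (i, j) \<in> vertices n \<and> (r, s) \<in> vertices n \<and>
        (i = r + 1 \<and> L (i, j) - L (r, s) \<in> \<nat> \<or>
         r = i + 1 \<and> L (i, j) - L (r, s) \<in> \<nat> - {0} \<or>
         i = n \<and> r = n \<and> j < s \<and> L (i, j) - L (r, s) \<in> \<nat>)}"

definition down_arrows :: "graph \<Rightarrow> graph" where
  "down_arrows H = {((i, j), (r, s)) \<in> H. i = r + 1}"

section \<open>The relation module\<close>

text \<open>
  The vector space with basis \<open>B\<close> consists of the finitely supported functions on tableaux with
  support in \<open>B\<close>; the basis vector of the tableau \<open>S\<close> is \<open>tab S\<close>.
\<close>

type_synonym gt_vector = "tableau \<Rightarrow>\<^sub>0 complex"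

definition tab :: "tableau \<Rightarrow> gt_vector" where
  "tab S = Poly_Mapping.single S 1"

definition scale :: "complex \<Rightarrow> gt_vector \<Rightarrow> gt_vector" where
  "scale c v = Poly_Mapping.map ((*) c) v"

definition tab_in :: "tableau set \<Rightarrow> tableau \<Rightarrow> gt_vector" where
  "tab_in B S = (if S \<in> B then tab S else 0)"

definition linear_extension :: "(tableau \<Rightarrow> gt_vector) \<Rightarrow> gt_vector \<Rightarrow> gt_vector" where
  "linear_extension f v =
     (\<Sum>S\<in>Poly_Mapping.keys v. scale (Poly_Mapping.lookup v S) (f S))"

text \<open>The Gelfand--Tsetlin formulas for \<open>E\<^sub>k\<^sub>,\<^sub>k\<^sub>+\<^sub>1\<close>, \<open>E\<^sub>k\<^sub>+\<^sub>1\<^sub>,\<^sub>k\<close> and \<open>E\<^sub>k\<^sub>k\<close>:\<close>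

definition gt_raise :: "tableau set \<Rightarrow> nat \<Rightarrow> tableau \<Rightarrow> gt_vector" where
  "gt_raise B k S =
     - (\<Sum>i = 1..k. scale
          ((\<Prod>j = 1..k + 1. S (k, i) - S (k + 1, j)) / (\<Prod>j\<in>{1..k} - {i}. S (k, i) - S (k, j)))
          (tab_in B (S((k, i) := S (k, i) + 1))))"

definition gt_lower :: "tableau set \<Rightarrow> nat \<Rightarrow> tableau \<Rightarrow> gt_vector" where
  "gt_lower B k S =
     (\<Sum>i = 1..k. scale
          ((\<Prod>j = 1..k - 1. S (k, i) - S (k - 1, j)) / (\<Prod>j\<in>{1..k} - {i}. S (k, i) - S (k, j)))
          (tab_in B (S((k, i) := S (k, i) - 1))))"

definition gt_diag :: "nat \<Rightarrow> tableau \<Rightarrow> gt_vector" where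
  "gt_diag k S =
     scale (of_nat k - 1 + (\<Sum>i = 1..k. S (k, i)) - (\<Sum>i = 1..k - 1. S (k - 1, i))) (tab S)"

text \<open>
  The formulas determine the action of the remaining matrix units: \<open>gt_upper B d i\<close> is the action of
  \<open>E\<^sub>i\<^sub>j\<close> for \<open>j = i + d + 1\<close>, through \<open>E\<^sub>i\<^sub>j = [E\<^sub>i\<^sub>,\<^sub>i\<^sub>+\<^sub>1, E\<^sub>i\<^sub>+\<^sub>1\<^sub>,\<^sub>j]\<close>, and \<open>gt_below B d j\<close> is the action of
  \<open>E\<^sub>i\<^sub>j\<close> for \<open>i = j + d + 1\<close>, through \<open>E\<^sub>i\<^sub>j = [E\<^sub>i\<^sub>,\<^sub>i\<^sub>-\<^sub>1, E\<^sub>i\<^sub>-\<^sub>1\<^sub>,\<^sub>j]\<close>.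
\<close>

definition commutator :: "(gt_vector \<Rightarrow> gt_vector) \<Rightarrow> (gt_vector \<Rightarrow> gt_vector) \<Rightarrow> gt_vector \<Rightarrow> gt_vector"
  where "commutator X Y v = X (Y v) - Y (X v)"

primrec gt_upper :: "tableau set \<Rightarrow> nat \<Rightarrow> nat \<Rightarrow> gt_vector \<Rightarrow> gt_vector" where
  "gt_upper B 0 i = linear_extension (gt_raise B i)"
| "gt_upper B (Suc d) i = commutator (linear_extension (gt_raise B i)) (gt_upper B d (i + 1))"

primrec gt_below :: "tableau set \<Rightarrow> nat \<Rightarrow> nat \<Rightarrow> gt_vector \<Rightarrow> gt_vector" where
  "gt_below B 0 j = linear_extension (gt_lower B j)"
| "gt_below B (Suc d) j =
     commutator (linear_extension (gt_lower B (j + d + 1))) (gt_below B d j)"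

definition gt_act :: "tableau set \<Rightarrow> nat \<Rightarrow> nat \<Rightarrow> gt_vector \<Rightarrow> gt_vector" where
  "gt_act B i j =
     (if i < j then gt_upper B (j - i - 1) i
      else if j < i then gt_below B (i - j - 1) j
      else linear_extension (gt_diag i))"

definition relation_module :: "nat \<Rightarrow> graph \<Rightarrow> tableau \<Rightarrow> gt_vector gl_rep" where
  "relation_module n G L =
     \<lparr> carrier = {v. Poly_Mapping.keys v \<subseteq> basis_tableaux n G L},
       mult = undefined, one = undefined, zero = 0, add = (+), smult = scale,
       act = gt_act (basis_tableaux n G L) \<rparr>"

section \<open>The subquotient containing a tableau\<close>

definition smaller_submodules :: "nat \<Rightarrow> graph \<Rightarrow> tableau \<Rightarrow> tableau \<Rightarrow> gt_vector set" where
  "smaller_submodules n G L R =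
     (let V = relation_module n G L in
        sum_of_submodules V
          {Q \<in> basis_tableaux n G L.
             tab Q \<in> U_orbit n V (tab R) \<and> U_orbit n V (tab Q) \<subset> U_orbit n V (tab R)}
          (\<lambda>Q. U_orbit n V (tab Q)))"

definition subquotient :: "nat \<Rightarrow> graph \<Rightarrow> tableau \<Rightarrow> tableau \<Rightarrow> gt_vector set gl_rep" where
  "subquotient n G L R =
     (let V = relation_module n G L in
        quotient_rep (V\<lparr>carrier := U_orbit n V (tab R)\<rparr>) (smaller_submodules n G L R))"

definition tab_class :: "nat \<Rightarrow> graph \<Rightarrow> tableau \<Rightarrow> tableau \<Rightarrow> tableau \<Rightarrow> gt_vector set" where
  "tab_class n G L R S = smaller_submodules n G L R +>\<^bsub>relation_module n G L\<^esub> tab S"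

definition basis_index :: "nat \<Rightarrow> graph \<Rightarrow> tableau \<Rightarrow> tableau \<Rightarrow> tableau set" where
  "basis_index n G L R =
     {S \<in> basis_tableaux n G L. down_arrows (graph_of n R) = down_arrows (graph_of n S)}"

end

theory Submission
  imports Defs
begin

text \<open>
  Raising or lowering an entry has a nonzero coefficient exactly when no arrow of $E^+$ gets lost,
  so the tableaux $T(S)$ with $E^+_{G(R)} \subseteq E^+_{G(S)}$ span a submodule. Conversely, any
  such $T(S)$ is reached from $T(R)$ by unit steps along which $E^+$ grows monotonically. What
  remains is to see that every submodule is spanned by tableaux. This is usually deduced from the
  Gelfand--Tsetlin subalgebra; here it is shown directly, by induction on the rows. Among tableaux
  that agree in the rows up to $k$, raising and then lowering the entry $x = l_{ki}$ acts, up to a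
  common nonzero factor, by the value at $x$ of the monic polynomial whose roots are the entries of
  row $k + 1$. These values at the $k$ distinct points $l_{k1}, \dots, l_{kk}$ and the sum of the
  roots, which is known from $E_{k+1,k+1}$, determine the polynomial and hence row $k + 1$.
\<close>

section \<open>Formal combinations of tableaux\<close>

text \<open>The obstacle in the row induction is that raising an entry x of row k may add an arrow
  to $E^+$; lowering it again would lose that arrow and so has coefficient zero. An arrow is added
  exactly when row k - 1 contains x + 1, so that entry has to be raised first, and so on downwards.
  Condition (vi) on adjoining pairs keeps this chain from getting stuck: entries x + 1 and x in one
  row force an entry x in the row above, and then the raising coefficient of x vanishes anyway. The
  preparatory moves concern only rows below k, so they carry over to all tableaux with the same
  first k rows, with common coefficients. Finally, the polynomial yields row k + 1 only as a set of
  values; the positions are recovered from conditions (ii) and (iv), which order integrally related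
  entries of a row strictly, and from the fact that basis tableaux differ by integers.\<close>

lemma lookup_scale [simp]: "Poly_Mapping.lookup (scale c v) T = c * Poly_Mapping.lookup v T"
  by (simp add: scale_def Poly_Mapping.map.rep_eq when_def)

lemma lookup_tab: "Poly_Mapping.lookup (tab S) T = (if T = S then 1 else 0)"
  by (auto simp: tab_def lookup_single when_def)

lemma tab_in_iff [simp]: "S \<in> B \<Longrightarrow> tab_in B S = tab S" "S \<notin> B \<Longrightarrow> tab_in B S = 0"
  by (simp_all add: tab_in_def)

lemma keys_tab [simp]: "Poly_Mapping.keys (tab S) = {S}"
  by (simp add: tab_def)

lemma scale_simps [simp]:
  "scale c 0 = 0" "scale 0 v = 0" "scale 1 v = v" "scale c (scale d v) = scale (c * d) v"
  by (simp_all add: poly_mapping_eq_iff fun_eq_iff)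

lemma scale_add: "scale c (u + v) = scale c u + scale c v"
  and scale_add_left: "scale (c + d) v = scale c v + scale d v"
  and scale_minus_one: "scale (- 1) v = - v"
  and scale_minus_left: "scale (- c) v = - scale c v"
  and scale_diff: "scale c (u - v) = scale c u - scale c v"
  by (simp_all add: poly_mapping_eq_iff fun_eq_iff lookup_add lookup_minus algebra_simps)

lemma scale_sum: "scale c (\<Sum>i\<in>I. f i) = (\<Sum>i\<in>I. scale c (f i))"
  by (simp add: poly_mapping_eq_iff fun_eq_iff lookup_sum sum_distrib_left)

lemma keys_scale: "Poly_Mapping.keys (scale c v) \<subseteq> Poly_Mapping.keys v"
  by (auto simp: in_keys_iff)

lemma lookup_linear_extension:
  "Poly_Mapping.lookup (linear_extension f v) U =
    (\<Sum>T\<in>Poly_Mapping.keys v. Poly_Mapping.lookup v T * Poly_Mapping.lookup (f T) U)"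
  by (simp add: linear_extension_def lookup_sum)

lemma linear_extension_superset:
  assumes "finite F" "Poly_Mapping.keys v \<subseteq> F"
  shows "linear_extension f v = (\<Sum>T\<in>F. scale (Poly_Mapping.lookup v T) (f T))"
  unfolding linear_extension_def
  by (rule sum.mono_neutral_left) (use assms in \<open>auto simp: in_keys_iff\<close>)

lemma linear_extension_cong:
  "(\<And>T. T \<in> Poly_Mapping.keys v \<Longrightarrow> f T = g T) \<Longrightarrow> linear_extension f v = linear_extension g v"
  by (simp add: linear_extension_def)

lemma linear_extension_zero [simp]: "linear_extension f 0 = 0"
  by (simp add: linear_extension_def)

lemma linear_extension_tab [simp]: "linear_extension f (tab S) = f S"
  by (simp add: linear_extension_def lookup_tab)

lemma linear_extension_add:
  "linear_extension f (u + v) = linear_extension f u + linear_extension f v"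
proof -
  let ?F = "Poly_Mapping.keys u \<union> Poly_Mapping.keys v"
  have "Poly_Mapping.keys (u + v) \<subseteq> ?F" by (rule keys_add)
  then show ?thesis
    by (simp add: linear_extension_superset[of ?F] lookup_add scale_add_left sum.distrib)
qed

lemma linear_extension_scale: "linear_extension f (scale c v) = scale c (linear_extension f v)"
  by (simp add: linear_extension_superset[of "Poly_Mapping.keys v"] keys_scale scale_sum)

lemma linear_extension_uminus: "linear_extension f (- v) = - linear_extension f v"
  using linear_extension_scale[of f "- 1" v] by (simp add: scale_minus_one)

lemma linear_extension_sum:
  "linear_extension f (\<Sum>i\<in>I. g i) = (\<Sum>i\<in>I. linear_extension f (g i))"
  by (induction I rule: infinite_finite_induct) (auto simp: linear_extension_add)

text \<open>Raising, lowering, diagonal operators and projections are all linear extensions; through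
  this rule an identity between composites becomes one on single tableaux in the support.\<close>

lemma linear_extension_compose:
  "linear_extension f (linear_extension g v) = linear_extension (\<lambda>T. linear_extension f (g T)) v"
  unfolding linear_extension_def[of g] linear_extension_def[of "\<lambda>T. linear_extension f (g T)"]
  by (simp add: linear_extension_sum linear_extension_scale)

lemma linear_extension_id [simp]: "linear_extension tab v = v"
  by (rule poly_mapping_eqI)
    (simp add: lookup_linear_extension lookup_tab in_keys_iff if_distrib[of "\<lambda>x. _ * x"] cong: if_cong)

lemma keys_linear_extension:
  "Poly_Mapping.keys (linear_extension f v) \<subseteq>
    (\<Union>T\<in>Poly_Mapping.keys v. Poly_Mapping.keys (f T))"
proof
  fix U assume "U \<in> Poly_Mapping.keys (linear_extension f v)"
  then have "(\<Sum>T\<in>Poly_Mapping.keys v. Poly_Mapping.lookup v T * Poly_Mapping.lookup (f T) U) \<noteq> 0"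
    by (simp add: in_keys_iff lookup_linear_extension)
  then obtain T where "T \<in> Poly_Mapping.keys v" "Poly_Mapping.lookup (f T) U \<noteq> 0"
    by (metis (no_types, lifting) mult_zero_right sum.neutral)
  then show "U \<in> (\<Union>T\<in>Poly_Mapping.keys v. Poly_Mapping.keys (f T))"
    by (auto simp: in_keys_iff)
qed

section \<open>Linear subspaces and coordinate projections\<close>

definition linear_subspace :: "gt_vector set \<Rightarrow> bool" where
  "linear_subspace W \<longleftrightarrow> 0 \<in> W \<and> (\<forall>u\<in>W. \<forall>v\<in>W. u + v \<in> W) \<and> (\<forall>c. \<forall>u\<in>W. scale c u \<in> W)"

lemma linear_subspaceD:
  assumes "linear_subspace W"
  shows linear_subspace_zero: "0 \<in> W"
    and linear_subspace_add: "u \<in> W \<Longrightarrow> v \<in> W \<Longrightarrow> u + v \<in> W"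
    and linear_subspace_scale: "u \<in> W \<Longrightarrow> scale c u \<in> W"
    and linear_subspace_uminus: "u \<in> W \<Longrightarrow> - u \<in> W"
proof -
  show "0 \<in> W" "u \<in> W \<Longrightarrow> v \<in> W \<Longrightarrow> u + v \<in> W"
    using assms unfolding linear_subspace_def by blast+
  show *: "u \<in> W \<Longrightarrow> scale c u \<in> W" for c
    using assms unfolding linear_subspace_def by blast
  show "u \<in> W \<Longrightarrow> - u \<in> W"
    using *[of "- 1"] unfolding scale_minus_one .
qed

lemma linear_subspace_diff:
  "linear_subspace W \<Longrightarrow> u \<in> W \<Longrightarrow> v \<in> W \<Longrightarrow> u - v \<in> W"
  using linear_subspace_add[of W u "- v"] linear_subspace_uminus[of W v] by simp

lemma linear_subspace_sum:
  "linear_subspace W \<Longrightarrow> (\<And>i. i \<in> I \<Longrightarrow> f i \<in> W) \<Longrightarrow> (\<Sum>i\<in>I. f i) \<in> W"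
  by (induction I rule: infinite_finite_induct)
    (auto intro: linear_subspace_zero linear_subspace_add)

lemma linear_subspace_linear_extension:
  "linear_subspace W \<Longrightarrow> (\<And>T. T \<in> Poly_Mapping.keys v \<Longrightarrow> f T \<in> W) \<Longrightarrow> linear_extension f v \<in> W"
  unfolding linear_extension_def by (intro linear_subspace_sum linear_subspace_scale)

definition tableau_span :: "tableau set \<Rightarrow> gt_vector set" where
  "tableau_span N = {v. Poly_Mapping.keys v \<subseteq> N}"

lemma linear_subspace_tableau_span: "linear_subspace (tableau_span N)"
  unfolding linear_subspace_def
proof (intro conjI ballI allI)
  show "0 \<in> tableau_span N" by (simp add: tableau_span_def)
  show "u + v \<in> tableau_span N" if "u \<in> tableau_span N" "v \<in> tableau_span N" for u v
    using that Poly_Mapping.keys_add[of u v] unfolding tableau_span_def by blast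
  show "scale c u \<in> tableau_span N" if "u \<in> tableau_span N" for c u
    using that keys_scale[of c u] unfolding tableau_span_def by blast
qed

lemma tab_in_tableau_span [simp]: "tab S \<in> tableau_span N \<longleftrightarrow> S \<in> N"
  by (simp add: tableau_span_def)

lemma tableau_span_subset:
  assumes "linear_subspace W" "\<And>T. T \<in> N \<Longrightarrow> tab T \<in> W"
  shows "tableau_span N \<subseteq> W"
proof
  fix v assume "v \<in> tableau_span N"
  then have "linear_extension tab v \<in> W"
    using assms by (intro linear_subspace_linear_extension) (auto simp: tableau_span_def)
  then show "v \<in> W" by simp
qed

lemma linear_extension_in_tableau_span:
  "(\<And>T. T \<in> Poly_Mapping.keys v \<Longrightarrow> f T \<in> tableau_span N) \<Longrightarrow>
    linear_extension f v \<in> tableau_span N"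
  by (rule linear_subspace_linear_extension[OF linear_subspace_tableau_span])

text \<open>The coordinate projection onto the tableaux with property \<open>P\<close>. As a linear
  extension it can be pushed through another one, see \<open>part_linear_extension\<close>.\<close>

definition part :: "(tableau \<Rightarrow> bool) \<Rightarrow> gt_vector \<Rightarrow> gt_vector" where
  "part P = linear_extension (\<lambda>T. if P T then tab T else 0)"

lemma lookup_part: "Poly_Mapping.lookup (part P v) T = (if P T then Poly_Mapping.lookup v T else 0)"
proof -
  have "Poly_Mapping.lookup (part P v) T =
      (\<Sum>S\<in>Poly_Mapping.keys v. if S = T then (if P T then Poly_Mapping.lookup v T else 0) else 0)"
    unfolding part_def lookup_linear_extension by (rule sum.cong) (auto simp: lookup_tab)
  then show ?thesis by (simp add: in_keys_iff)
qed

lemma keys_part: "Poly_Mapping.keys (part P v) = {T \<in> Poly_Mapping.keys v. P T}"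
  by (auto simp: in_keys_iff lookup_part split: if_splits)

lemma part_part: "part P (part Q v) = part (\<lambda>T. P T \<and> Q T) v"
  by (simp add: poly_mapping_eq_iff fun_eq_iff lookup_part)

lemma part_cong: "(\<And>T. T \<in> Poly_Mapping.keys v \<Longrightarrow> P T \<longleftrightarrow> Q T) \<Longrightarrow> part P v = part Q v"
  unfolding part_def by (rule linear_extension_cong) simp

lemma part_self: "(\<And>T. T \<in> Poly_Mapping.keys v \<Longrightarrow> P T) \<Longrightarrow> part P v = v"
  using part_cong[of v P "\<lambda>_. True"] by (simp add: part_def)

lemma part_linear_extension:
  "part P (linear_extension f v) = linear_extension (\<lambda>T. part P (f T)) v"
  unfolding part_def by (rule linear_extension_compose)

text \<open>The component is cut out by the Lagrange factors \<open>(e - d) / (c - d)\<close>, where \<open>d\<close> runs over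
  the other eigenvalues.\<close>

lemma eigen_component:
  assumes W: "linear_subspace W"
    and diag: "\<And>w. w \<in> W \<Longrightarrow> Poly_Mapping.keys w \<subseteq> F \<Longrightarrow>
        linear_extension (\<lambda>T. scale (e T) (tab T)) w \<in> W"
    and v: "v \<in> W" "Poly_Mapping.keys v \<subseteq> F"
  shows "part (\<lambda>T. e T = c) v \<in> W"
proof -
  have *: "linear_extension (\<lambda>T. scale (\<Prod>d\<in>D. (e T - d) / (c - d)) (tab T)) v \<in> W"
    (is "?w D \<in> W") if "finite D" for D
    using that
  proof induction
    case empty
    then show ?case using v by simp
  next
    case (insert d D)
    \<comment> \<open>The support is tracked because the operator is known to preserve
      \<open>W\<close> only on vectors supported in \<open>F\<close>; in the row induction
      \<open>F\<close> prescribes the first rows.\<close>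
    have "Poly_Mapping.keys (?w D) \<subseteq> F"
      using keys_linear_extension[of "\<lambda>T. scale (\<Prod>d\<in>D. (e T - d) / (c - d)) (tab T)" v]
        keys_scale v(2) by fastforce
    then have "scale (1 / (c - d)) (linear_extension (\<lambda>T. scale (e T) (tab T)) (?w D)
        - scale d (?w D)) \<in> W" (is "?u \<in> W")
      using insert.IH diag W
      by (intro linear_subspace_scale linear_subspace_diff) auto
    moreover have "?u = ?w (insert d D)"
    proof -
      have "?u = linear_extension (\<lambda>T. scale (\<Prod>d\<in>D. (e T - d) / (c - d))
          (scale (e T / (c - d)) (tab T) - scale (d / (c - d)) (tab T))) v"
        unfolding linear_extension_compose linear_extension_scale linear_extension_tab
        unfolding linear_extension_def scale_sum sum_subtractf[symmetric]
        by (simp add: scale_diff mult_ac)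
      also have "\<dots> = ?w (insert d D)"
        using insert.hyps
        by (intro linear_extension_cong)
          (simp add: poly_mapping_eq_iff fun_eq_iff lookup_minus diff_divide_distrib algebra_simps)
      finally show ?thesis .
    qed
    ultimately show ?case by simp
  qed
  \<comment> \<open>Leaving out \<open>c\<close> keeps the denominators nonzero, and every other
    eigenvalue on \<open>v\<close> is some \<open>d\<close>, so its tableaux are
    annihilated.\<close>
  let ?D = "e ` Poly_Mapping.keys v - {c}"
  have "?w ?D = part (\<lambda>T. e T = c) v"
    unfolding part_def
  proof (rule linear_extension_cong)
    fix T assume T: "T \<in> Poly_Mapping.keys v"
    show "scale (\<Prod>d\<in>?D. (e T - d) / (c - d)) (tab T) = (if e T = c then tab T else 0)"
    proof (cases "e T = c")
      case True
      then have "(\<Prod>d\<in>?D. (e T - d) / (c - d)) = 1"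
        by (intro prod.neutral) auto
      then show ?thesis using True by simp
    next
      case False
      then have zero: "(\<Prod>d\<in>?D. (e T - d) / (c - d)) = 0"
        using T by (intro prod_zero) auto
      show ?thesis unfolding zero using False by simp
    qed
  qed
  then show ?thesis using *[of ?D] by simp
qed

section \<open>Integral shifts of tableaux\<close>

definition shift :: "(vertex \<Rightarrow> int) \<Rightarrow> tableau \<Rightarrow> tableau" where
  "shift z T = (\<lambda>p. T p + of_int (z p))"

definition delta :: "vertex \<Rightarrow> vertex \<Rightarrow> int" where
  "delta a = (\<lambda>p. if p = a then 1 else 0)"

lemma shift_apply [simp]: "shift z T p = T p + of_int (z p)"
  by (simp add: shift_def)

lemma shift_zero [simp]: "shift (\<lambda>p. 0) T = T"
  by (simp add: shift_def)

lemma shift_shift: "shift z (shift w T) = shift (\<lambda>p. w p + z p) T"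
  by (simp add: shift_def add.assoc)

lemma delta_same [simp]: "delta a a = 1"
  by (simp add: delta_def)

lemma delta_other [simp]: "p \<noteq> a \<Longrightarrow> delta a p = 0"
  by (simp add: delta_def)

lemma shift_delta: "shift (delta a) T = T(a := T a + 1)"
  and shift_minus_delta: "shift (\<lambda>p. - delta a p) T = T(a := T a - 1)"
  by (auto simp: fun_eq_iff delta_def)

text \<open>The arrow set $E^+_{G(T)}$ of the statement.\<close>

definition descents :: "nat \<Rightarrow> tableau \<Rightarrow> graph" where
  "descents n T = down_arrows (graph_of n T)"

lemma descents_iff:
  "(p, q) \<in> descents n T \<longleftrightarrow>
    p \<in> vertices n \<and> q \<in> vertices n \<and> fst p = fst q + 1 \<and> T p - T q \<in> \<nat>"
  by (cases p; cases q) (auto simp: descents_def down_arrows_def graph_of_def)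

text \<open>Turns a missing downward arrow between integrally related entries into the strict
  inequality that an upward arrow demands.\<close>

lemma Ints_pos_cases:
  fixes x :: complex
  assumes "x \<in> \<int>" "- x \<notin> \<nat>"
  shows "x \<in> \<nat> - {0}"
proof -
  obtain m where m: "x = of_int m" using assms(1) by (auto elim: Ints_cases)
  have "m > 0"
  proof (rule ccontr)
    assume "\<not> m > 0"
    then have "- x = of_nat (nat (- m))" by (simp add: m)
    then show False using assms(2) by (metis of_nat_in_Nats)
  qed
  then have "x = of_nat (nat m)" "x \<noteq> 0" by (simp_all add: m)
  then show ?thesis by (metis DiffI of_nat_in_Nats singletonD)
qed

lemma of_int_in_Nats_iff: "(of_int m :: complex) \<in> \<nat> \<longleftrightarrow> 0 \<le> m"
proof
  assume "(of_int m :: complex) \<in> \<nat>"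
  then obtain k where "(of_int m :: complex) = of_nat k" by (auto elim: Nats_cases)
  then have "(of_int m :: complex) = of_int (int k)" by simp
  then show "0 \<le> m" unfolding of_int_eq_iff by simp
next
  assume "0 \<le> m"
  then show "(of_int m :: complex) \<in> \<nat>" by (metis of_int_of_nat_eq of_nat_in_Nats zero_le_imp_eq_int)
qed

lemma Nats_imp_Ints: "x \<in> \<nat> \<Longrightarrow> x \<in> (\<int> :: complex set)"
  by (metis Ints_of_nat Nats_cases)

lemma Ints_add_of_int_iff: "(x::complex) + of_int m \<in> \<int> \<longleftrightarrow> x \<in> \<int>"
  by (metis Ints_add Ints_diff Ints_of_int add_diff_cancel_right')

section \<open>Basis tableaux: order and gaps within a row\<close>

locale relation_setting =
  fixes n :: nat and G :: graph and L :: tableau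
  assumes graph: "relation_graph n G" and real: "realization n G L"
begin

abbreviation B :: "tableau set" where "B \<equiv> basis_tableaux n G L"

lemma arrow_vertices: "(p, q) \<in> G \<Longrightarrow> p \<in> vertices n \<and> q \<in> vertices n"
  using graph unfolding relation_graph_def by blast

lemma arrow_rows:
  assumes "(p, q) \<in> G"
  shows "fst p = fst q + 1 \<or> fst q = fst p + 1 \<or> (fst p = n \<and> fst q = n)"
proof -
  have "\<forall>((i, j), (r, s))\<in>G. i = r + 1 \<or> r = i + 1 \<or> (i = n \<and> r = n)"
    using graph unfolding relation_graph_def by (elim conjE)
  then show ?thesis using assms by (cases p; cases q) auto
qed

lemma no_backward_path:
  "k \<le> n \<Longrightarrow> 1 \<le> i \<Longrightarrow> i < j \<Longrightarrow> j \<le> k \<Longrightarrow> ((k, j), (k, i)) \<notin> G\<^sup>+"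
  using graph unfolding relation_graph_def by blast

lemma component_path:
  "1 \<le> k \<Longrightarrow> k < n \<Longrightarrow> i \<in> {1..k} \<Longrightarrow> j \<in> {1..k} \<Longrightarrow> same_component G (k, i) (k, j) \<Longrightarrow>
    ((k, i), (k, j)) \<in> G\<^sup>* \<or> ((k, j), (k, i)) \<in> G\<^sup>*"
  using graph unfolding relation_graph_def by blast

lemma adjoining_arrows:
  assumes "adjoining n G k i j"
  obtains (diamond) p where "p \<in> {1..k + 1}" "((k, i), (k + 1, p)) \<in> G" "((k + 1, p), (k, j)) \<in> G"
  | (roof) s t where "1 \<le> s" "s < t" "t \<le> k + 1"
      "((k, i), (k + 1, s)) \<in> G" "((k + 1, t), (k, j)) \<in> G"
  using assms graph unfolding relation_graph_def by meson

lemma satisfies_iff: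
  "satisfies G T \<longleftrightarrow> (\<forall>p q. (p, q) \<in> G \<longrightarrow>
    (fst q = fst p + 1 \<longrightarrow> T p - T q \<in> \<nat> - {0}) \<and> (fst q \<noteq> fst p + 1 \<longrightarrow> T p - T q \<in> \<nat>))"
proof -
  have "satisfies G T \<longleftrightarrow> (\<forall>p q. (p, q) \<in> G \<longrightarrow>
    (fst p = fst q \<or> fst p = fst q + 1 \<longrightarrow> T p - T q \<in> \<nat>) \<and> (fst q = fst p + 1 \<longrightarrow> T p - T q \<in> \<nat> - {0}))"
    unfolding satisfies_def by fastforce
  then show ?thesis
    using arrow_rows by (metis DiffD1)
qed

lemma int_shiftsI: "(\<And>p. p \<notin> vertices n \<Longrightarrow> z p = 0) \<Longrightarrow> (\<And>i. z (n, i) = 0) \<Longrightarrow> z \<in> int_shifts n"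
  by (simp add: int_shifts_def)

lemma int_shifts_outside: "z \<in> int_shifts n \<Longrightarrow> p \<notin> vertices n \<or> fst p = n \<Longrightarrow> z p = 0"
  by (cases p) (auto simp: int_shifts_def)

lemma int_shifts_add: "z \<in> int_shifts n \<Longrightarrow> w \<in> int_shifts n \<Longrightarrow> (\<lambda>p. z p + w p) \<in> int_shifts n"
  by (simp add: int_shifts_def)

lemma int_shifts_diff: "z \<in> int_shifts n \<Longrightarrow> w \<in> int_shifts n \<Longrightarrow> (\<lambda>p. z p - w p) \<in> int_shifts n"
  by (simp add: int_shifts_def)

lemma int_shifts_minus: "z \<in> int_shifts n \<Longrightarrow> (\<lambda>p. - z p) \<in> int_shifts n"
  by (simp add: int_shifts_def)

lemma delta_int_shifts:
  "a \<in> vertices n \<Longrightarrow> fst a < n \<Longrightarrow> delta a \<in> int_shifts n"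
  by (rule int_shiftsI) (auto simp: delta_def)

text \<open>Integral shifts do not change whether a difference of entries is integral, so the second
  condition on realizations carries over from \<open>L\<close>; only the arrow inequalities
  remain.\<close>

lemma realization_shift:
  "z \<in> int_shifts n \<Longrightarrow> realization n G (shift z L) \<longleftrightarrow> satisfies G (shift z L)"
proof -
  have "(L p + of_int a) - (L q + of_int b) \<in> \<int> \<longleftrightarrow> L p - L q \<in> \<int>" for p q a b
    using Ints_add_of_int_iff[of "L p - L q" "a - b"] by (simp add: algebra_simps)
  then show ?thesis
    using real unfolding realization_def by simp
qed

lemma basis_iff:
  "T \<in> B \<longleftrightarrow> (\<exists>z\<in>int_shifts n. T = shift z L) \<and> satisfies G T"
  unfolding basis_tableaux_def shift_def[symmetric] using realization_shift by blast

lemma basis_shift_iff: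
  assumes "T \<in> B" "z \<in> int_shifts n"
  shows "shift z T \<in> B \<longleftrightarrow> satisfies G (shift z T)"
proof -
  obtain w where "w \<in> int_shifts n" "T = shift w L" using assms(1) basis_iff by blast
  then have "shift z T = shift (\<lambda>p. w p + z p) L" "(\<lambda>p. w p + z p) \<in> int_shifts n"
    using assms by (simp_all add: shift_shift int_shifts_add)
  then show ?thesis using basis_iff by blast
qed

lemma basis_shift_between:
  assumes "T \<in> B" "U \<in> B"
  obtains z where "z \<in> int_shifts n" "U = shift z T"
proof -
  obtain w x where w: "w \<in> int_shifts n" "T = shift w L" and x: "x \<in> int_shifts n" "U = shift x L"
    using assms basis_iff by metis
  have "U = shift (\<lambda>p. x p - w p) T" by (simp add: fun_eq_iff w x)
  then show ?thesis using that int_shifts_diff[OF x(1) w(1)] by blast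
qed

lemma basis_outside: "T \<in> B \<Longrightarrow> U \<in> B \<Longrightarrow> p \<notin> vertices n \<or> fst p = n \<Longrightarrow> T p = U p"
  by (metis basis_shift_between int_shifts_outside of_int_0 add_0_right shift_apply)

lemma basis_diff_Ints: "T \<in> B \<Longrightarrow> U \<in> B \<Longrightarrow> U p - T p \<in> \<int>"
  by (metis Ints_of_int add_diff_cancel_left' basis_shift_between shift_apply)

lemma basis_satisfies: "T \<in> B \<Longrightarrow> satisfies G T"
  using basis_iff by blast

lemma basis_same_component:
  assumes "T \<in> B" "1 \<le> k" "k < n" "i \<in> {1..k}" "j \<in> {1..k}" "T (k, i) - T (k, j) \<in> \<int>"
  shows "same_component G (k, i) (k, j)"
  using assms unfolding basis_tableaux_def realization_def by auto

text \<open>Every arrow weakly decreases the entry, and strictly when it points up. Equality along a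
  path therefore means that it never climbs, so a path returning to its row below the top one
  decreases strictly.\<close>

lemma path_decrease:
  assumes T: "T \<in> B" and "(p, q) \<in> G\<^sup>+"
  shows "T p - T q \<in> \<nat> - {0} \<or>
    (T p = T q \<and> (fst q < fst p \<or> (fst q = n \<and> fst p = n)))"
  using assms(2)
proof (induction rule: trancl_induct)
  case (base q)
  then show ?case
    using arrow_rows[OF base] basis_satisfies[OF T] unfolding satisfies_iff
    by (cases "T p = T q") fastforce+
next
  case (step q r)
  have qr: "T q - T r \<in> \<nat> - {0} \<or>
      (T q = T r \<and> (fst r < fst q \<or> (fst r = n \<and> fst q = n)))"
    using arrow_rows[OF step(2)] basis_satisfies[OF T] step(2) unfolding satisfies_iff
    by (cases "T q = T r") fastforce+
  have add: "x + y \<in> \<nat> - {0}" if "x \<in> \<nat> - {0}" "y \<in> \<nat> - {0}" for x y :: complex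
    using that by (auto elim!: Nats_cases simp flip: of_nat_add)
  have "q \<in> vertices n" "r \<in> vertices n" using arrow_vertices[OF step(2)] by auto
  then have rn: "fst r \<le> n" by (auto simp: vertices_def)
  show ?case
    using step.IH qr add[of "T p - T q" "T q - T r"] rn by auto
qed

text \<open>An integral difference puts both vertices into one component; condition (iv) then
  supplies a path and condition (ii) fixes its direction.\<close>

lemma row_decreasing:
  assumes T: "T \<in> B" and k: "k < n" and ij: "1 \<le> i" "i < j" "j \<le> k"
    and int: "T (k, i) - T (k, j) \<in> \<int>"
  shows "((k, i), (k, j)) \<in> G\<^sup>+" and "T (k, i) - T (k, j) \<in> \<nat> - {0}"
proof -
  have "same_component G (k, i) (k, j)"
    using basis_same_component[OF T] assms by auto
  then have "((k, i), (k, j)) \<in> G\<^sup>* \<or> ((k, j), (k, i)) \<in> G\<^sup>*"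
    using component_path k ij by auto
  moreover have "((k, j), (k, i)) \<notin> G\<^sup>+" using no_backward_path k ij by auto
  ultimately show "((k, i), (k, j)) \<in> G\<^sup>+"
    using ij by (auto simp: rtrancl_eq_or_trancl)
  from path_decrease[OF T this] show "T (k, i) - T (k, j) \<in> \<nat> - {0}"
    using k by auto
qed

lemma row_distinct:
  assumes "T \<in> B" "k < n" "i \<in> {1..k}" "j \<in> {1..k}" "T (k, i) = T (k, j)"
  shows "i = j"
proof (rule ccontr)
  assume "i \<noteq> j"
  then consider "i < j" | "j < i" by linarith
  then show False
  proof cases
    case 1
    then show False using row_decreasing(2)[OF assms(1,2), of i j] assms(3-5) by auto
  next
    case 2
    then show False using row_decreasing(2)[OF assms(1,2), of j i] assms(3-5) by auto
  qed
qed

text \<open>No integrally related entry fits strictly between two entries at distance 1, so their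
  vertices are adjoining and condition (vi) applies. Its first alternative squeezes an entry of the
  row above onto the smaller value.\<close>

lemma row_gap:
  assumes T: "T \<in> B" and k: "k + 1 < n" and i: "i \<in> {1..k}" and j: "j \<in> {1..k}"
    and gap: "T (k, i) = T (k, j) + 1"
  obtains p where "p \<in> {1..k + 1}" "T (k + 1, p) = T (k, j)"
proof -
  have "\<not> j < i"
  proof
    assume "j < i"
    moreover have "T (k, j) - T (k, i) = of_int (- 1)" using gap by simp
    ultimately have "(of_int (- 1) :: complex) \<in> \<nat>"
      using row_decreasing(2)[OF T, of k j i] k i j by (metis DiffD1 Ints_of_int add_lessD1 atLeastAtMost_iff)
    then show False unfolding of_int_in_Nats_iff by simp
  qed
  moreover have "i \<noteq> j" using gap by auto
  ultimately have ij: "i < j" by simp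
  have two: False if xyz: "x \<in> \<nat> - {0}" "y \<in> \<nat> - {0}" "z \<in> \<nat>"
    and sum: "x + y + z = 1" for x y z :: complex
  proof -
    obtain a b c where "x = of_nat a" "y = of_nat b" "z = of_nat c" "a \<noteq> 0" "b \<noteq> 0"
      using xyz by (auto elim!: Nats_cases)
    with sum have "of_nat (a + b + c) = (of_nat 1 :: complex)" by simp
    then have "a + b + c = 1" by (simp only: of_nat_eq_iff)
    with \<open>a \<noteq> 0\<close> \<open>b \<noteq> 0\<close> show False by simp
  qed
  have path: "((k, i), (k, j)) \<in> G\<^sup>+"
    using row_decreasing(1)[OF T _ _ ij] i j k gap by auto
  have strict: "T (k, s) - T (k, t) \<in> \<nat> - {0}" if "((k, s), (k, t)) \<in> G\<^sup>+" for s t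
    using path_decrease[OF T that] k by auto
  \<comment> \<open>If one of the two differences is a positive integer, the other is an integer as
    well, and the order of the indices makes it positive; their sum then exceeds the gap.\<close>
  have between: "((k, i), (k, t)) \<notin> G\<^sup>+ \<and> ((k, t), (k, j)) \<notin> G\<^sup>+" if t: "i < t" "t < j" for t
  proof -
    have "\<not> (T (k, i) - T (k, t) \<in> \<nat> - {0} \<and> T (k, t) - T (k, j) \<in> \<nat> - {0})"
      using two[of "T (k, i) - T (k, t)" "T (k, t) - T (k, j)" 0] gap by auto
    moreover have "T (k, t) - T (k, j) \<in> \<nat> - {0}" if "T (k, i) - T (k, t) \<in> \<nat> - {0}"
    proof -
      have "T (k, t) - T (k, j) = 1 - (T (k, i) - T (k, t))" using gap by simp
      also have "\<dots> \<in> \<int>" using that by (metis DiffD1 Ints_1 Ints_diff Nats_imp_Ints)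
      finally show ?thesis using row_decreasing(2)[OF T, of k t j] k i j t by auto
    qed
    moreover have "T (k, i) - T (k, t) \<in> \<nat> - {0}" if "T (k, t) - T (k, j) \<in> \<nat> - {0}"
    proof -
      have "T (k, i) - T (k, t) = 1 - (T (k, t) - T (k, j))" using gap by simp
      also have "\<dots> \<in> \<int>" using that by (metis DiffD1 Ints_1 Ints_diff Nats_imp_Ints)
      finally show ?thesis using row_decreasing(2)[OF T, of k i t] k i j t by auto
    qed
    ultimately show ?thesis using strict by blast
  qed
  have "adjoining n G k i j"
    unfolding adjoining_def using i j ij k path between by auto
  then show ?thesis
  proof (cases rule: adjoining_arrows)
    case (diamond p)
    have up: "T (k, i) - T (k + 1, p) \<in> \<nat> - {0}" and down: "T (k + 1, p) - T (k, j) \<in> \<nat>"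
      using basis_satisfies[OF T] diamond unfolding satisfies_iff by fastforce+
    have "T (k + 1, p) = T (k, j)"
    proof (rule ccontr)
      assume "T (k + 1, p) \<noteq> T (k, j)"
      then show False
        using two[OF up, of "T (k + 1, p) - T (k, j)" 0] down gap by simp
    qed
    then show ?thesis using that diamond(1) by blast
  next
    \<comment> \<open>Row k + 1 is still below the top, so its two entries are themselves strictly
      ordered. Two strict drops do not fit into a gap of 1.\<close>
    case (roof s t)
    have up: "T (k, i) - T (k + 1, s) \<in> \<nat> - {0}" and down: "T (k + 1, t) - T (k, j) \<in> \<nat>"
      using basis_satisfies[OF T] roof unfolding satisfies_iff by fastforce+
    have "T (k + 1, s) - T (k + 1, t) =
        1 - (T (k, i) - T (k + 1, s)) - (T (k + 1, t) - T (k, j))" using gap by simp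
    also have "\<dots> \<in> \<int>" using up down by (metis DiffD1 Ints_1 Ints_diff Nats_imp_Ints)
    finally have "T (k + 1, s) - T (k + 1, t) \<in> \<nat> - {0}"
      using row_decreasing(2)[OF T, of "k + 1" s t] k roof(1-3) by auto
    then have False
      by (rule two[OF up _ down]) (use gap in simp)
    then show ?thesis ..
  qed
qed

text \<open>Rows are determined by their sets of values: in the first position where two rows differ,
  each entry of the pair would have to reappear further right in the other row, hence be the
  smaller one.\<close>

lemma row_eqI:
  assumes T: "T \<in> B" and U: "U \<in> B" and k: "k < n"
    and vals: "(\<lambda>j. T (k, j)) ` {1..k} = (\<lambda>j. U (k, j)) ` {1..k}"
  shows "T (k, j) = U (k, j)"
proof -
  have less: "\<exists>i. U (k, j) = T (k, i) \<and> T (k, j) - U (k, j) \<in> \<nat> - {0}"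
    if TU: "T \<in> B" "U \<in> B" and j: "j \<in> {1..k}" and ne: "T (k, j) \<noteq> U (k, j)"
      and prev: "\<And>i. i \<in> {1..k} \<Longrightarrow> i < j \<Longrightarrow> T (k, i) = U (k, i)"
      and vals: "(\<lambda>j. U (k, j)) ` {1..k} \<subseteq> (\<lambda>j. T (k, j)) ` {1..k}" for T U j
  proof -
    have "U (k, j) \<in> (\<lambda>j. T (k, j)) ` {1..k}" using vals j by (rule subsetD[OF _ imageI])
    then obtain i where i: "i \<in> {1..k}" "U (k, j) = T (k, i)" by blast
    have "\<not> i < j" using prev[OF i(1)] i row_distinct[OF TU(2) k i(1) j] by auto
    moreover have "i \<noteq> j" using i ne by auto
    ultimately have "j < i" by simp
    moreover have "T (k, j) - T (k, i) \<in> \<int>"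
      using basis_diff_Ints[OF TU(2,1), of "(k, j)"] i by simp
    ultimately show ?thesis
      using row_decreasing(2)[OF TU(1) k] i j by auto
  qed
  have "\<forall>j\<in>{1..k}. T (k, j) = U (k, j)"
  proof (rule ccontr)
    assume "\<not> ?thesis"
    then obtain j where "j \<in> {1..k} \<and> T (k, j) \<noteq> U (k, j)"
      and "\<forall>i<j. \<not> (i \<in> {1..k} \<and> T (k, i) \<noteq> U (k, i))"
      using exists_least_iff[of "\<lambda>j. j \<in> {1..k} \<and> T (k, j) \<noteq> U (k, j)"] by blast
    then have j: "j \<in> {1..k}" "T (k, j) \<noteq> U (k, j)"
      and prev: "\<And>i. i \<in> {1..k} \<Longrightarrow> i < j \<Longrightarrow> T (k, i) = U (k, i)" by blast+
    have 1: "T (k, j) - U (k, j) \<in> \<nat> - {0}"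
      using less[OF T U j(1,2) prev] vals by blast
    have 2: "U (k, j) - T (k, j) \<in> \<nat> - {0}"
      using less[OF U T j(1) j(2)[symmetric] prev[symmetric]] vals by blast
    obtain a b where ab: "T (k, j) - U (k, j) = of_nat a" "U (k, j) - T (k, j) = of_nat b"
      using 1 2 by (auto elim!: Nats_cases)
    have "a \<noteq> 0" using ab(1) 1 by auto
    have "of_nat (a + b) = (T (k, j) - U (k, j)) + (U (k, j) - T (k, j))"
      unfolding ab by simp
    then have "of_nat (a + b) = (of_nat 0 :: complex)" by simp
    then have "a + b = 0" by (simp only: of_nat_eq_iff)
    then show False using \<open>a \<noteq> 0\<close> by simp
  qed
  \<comment> \<open>The claim covers all \<open>j\<close>: outside the triangle all basis tableaux
    coincide.\<close>
  then show ?thesis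
    using basis_outside[OF T U, of "(k, j)"] by (cases "j \<in> {1..k}") (auto simp: vertices_def)
qed

end

section \<open>How one unit step changes the downward arrows\<close>

lemma Nats_plus_one_cases: "(x::complex) + 1 \<in> \<nat> \<Longrightarrow> x \<in> \<nat> \<or> x = - 1"
proof -
  assume "x + 1 \<in> \<nat>"
  then obtain m where m: "x + 1 = of_nat m" by (auto elim: Nats_cases)
  show ?thesis
  proof (cases m)
    case 0
    then show ?thesis using m by (simp add: eq_neg_iff_add_eq_0)
  next
    case (Suc l)
    then have "x = of_nat l" using m by simp
    then show ?thesis by simp
  qed
qed

lemma Nats_minus_one: "(x::complex) \<in> \<nat> \<Longrightarrow> x \<noteq> 0 \<Longrightarrow> x - 1 \<in> \<nat>"
  using Nats_plus_one_cases[of "x - 1"] by auto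

lemma Nats_antisym: "(x::complex) \<in> \<nat> \<Longrightarrow> - x \<in> \<nat> \<Longrightarrow> x = 0"
proof -
  assume "x \<in> \<nat>" "- x \<in> \<nat>"
  then obtain m where m: "x = of_nat m" by (auto elim: Nats_cases)
  then have "(of_int (- int m) :: complex) \<in> \<nat>" using \<open>- x \<in> \<nat>\<close> by simp
  then show "x = 0" unfolding of_int_in_Nats_iff m by simp
qed

text \<open>For the choice of the next entry to move: up to sign, \<open>f\<close> is the real part
  of an entry and \<open>g\<close> its row. Real parts suffice, since blocking entries lie at
  integral distance.\<close>

lemma lexicographic_maximum:
  fixes f :: "'a \<Rightarrow> real" and g :: "'a \<Rightarrow> int"
  assumes "finite P" "P \<noteq> {}"
  obtains a where "a \<in> P" "\<And>b. b \<in> P \<Longrightarrow> f b < f a \<or> (f b = f a \<and> g b \<le> g a)"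
proof -
  have "Max (f ` P) \<in> f ` P" using assms by simp
  then have ne: "{a \<in> P. f a = Max (f ` P)} \<noteq> {}" (is "?Q \<noteq> {}") by force
  then have "Max (g ` ?Q) \<in> g ` ?Q" using assms by simp
  then obtain a where a: "a \<in> P" "f a = Max (f ` P)" "g a = Max (g ` ?Q)" by force
  have "f b < f a \<or> (f b = f a \<and> g b \<le> g a)" if b: "b \<in> P" for b
  proof (cases "f b = f a")
    case True
    then have "g b \<in> g ` ?Q" using a b by simp
    then show ?thesis using a(3) True assms by (auto intro: Max_ge)
  next
    case False
    have "f b \<le> f a" using a(2) b assms by simp
    then show ?thesis using False by simp
  qed
  then show ?thesis using that a(1) by blast
qed

text \<open>Raising \<open>a\<close> shortens only the differences along arrows into
  \<open>a\<close>, and by 1, so an arrow is lost only where the difference was 0. Lowering does the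
  same to arrows out of \<open>a\<close>.\<close>

lemma descents_raise_superset:
  assumes "\<And>p. p \<in> vertices n \<Longrightarrow> fst p = fst a + 1 \<Longrightarrow> T p \<noteq> T a"
  shows "descents n T \<subseteq> descents n (shift (delta a) T)"
proof clarify
  fix p q :: vertex assume pq: "(p, q) \<in> descents n T"
  then have v: "p \<in> vertices n" "q \<in> vertices n" "fst p = fst q + 1" and d: "T p - T q \<in> \<nat>"
    by (simp_all add: descents_iff)
  have "shift (delta a) T p - shift (delta a) T q \<in> \<nat>"
  proof (cases "q = a")
    case True
    then have "p \<noteq> a" "T p - T q \<noteq> 0" using v assms by auto
    then show ?thesis using Nats_minus_one[OF d] True by (simp add: diff_diff_eq)
  next
    case False
    then show ?thesis
      using d Nats_add[OF d Nats_1] by (cases "p = a") (simp_all add: algebra_simps)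
  qed
  then show "(p, q) \<in> descents n (shift (delta a) T)" using v by (simp add: descents_iff)
qed

lemma descents_lower_superset:
  assumes "\<And>q. q \<in> vertices n \<Longrightarrow> fst a = fst q + 1 \<Longrightarrow> T q \<noteq> T a"
  shows "descents n T \<subseteq> descents n (shift (\<lambda>p. - delta a p) T)"
proof clarify
  fix p q :: vertex assume pq: "(p, q) \<in> descents n T"
  then have v: "p \<in> vertices n" "q \<in> vertices n" "fst p = fst q + 1" and d: "T p - T q \<in> \<nat>"
    by (simp_all add: descents_iff)
  have "shift (\<lambda>p. - delta a p) T p - shift (\<lambda>p. - delta a p) T q \<in> \<nat>"
  proof (cases "p = a")
    case True
    then have "q \<noteq> a" "T p - T q \<noteq> 0" using v assms[of q] by auto
    then show ?thesis using Nats_minus_one[OF d] True by (simp add: algebra_simps)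
  next
    case False
    then show ?thesis
      using d Nats_add[OF d Nats_1] by (cases "q = a") (simp_all add: algebra_simps)
  qed
  then show "(p, q) \<in> descents n (shift (\<lambda>p. - delta a p) T)" using v by (simp add: descents_iff)
qed

lemma not_minus_one_Nats: "- 1 \<notin> (\<nat> :: complex set)"
  using of_int_in_Nats_iff[of "- 1"] by simp

text \<open>For \<open>a\<close> below the top row, the right-hand side says that the numerator of
  the raising coefficient at \<open>a\<close> has no zero factor.\<close>

lemma descents_raise_superset_iff:
  assumes "a \<in> vertices n"
  shows "descents n T \<subseteq> descents n (shift (delta a) T) \<longleftrightarrow>
    (\<forall>p\<in>vertices n. fst p = fst a + 1 \<longrightarrow> T p \<noteq> T a)"
proof
  assume sub: "descents n T \<subseteq> descents n (shift (delta a) T)"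
  show "\<forall>p\<in>vertices n. fst p = fst a + 1 \<longrightarrow> T p \<noteq> T a"
  proof (intro ballI impI notI)
    fix p assume p: "p \<in> vertices n" "fst p = fst a + 1" "T p = T a"
    then have "(p, a) \<in> descents n T" "p \<noteq> a" using assms by (auto simp: descents_iff)
    then have "(p, a) \<in> descents n (shift (delta a) T)" "p \<noteq> a" using sub by auto
    then show False using p not_minus_one_Nats by (simp add: descents_iff)
  qed
qed (intro descents_raise_superset, blast)

lemma descents_lower_superset_iff:
  assumes "a \<in> vertices n"
  shows "descents n T \<subseteq> descents n (shift (\<lambda>p. - delta a p) T) \<longleftrightarrow>
    (\<forall>q\<in>vertices n. fst a = fst q + 1 \<longrightarrow> T q \<noteq> T a)"
proof
  assume sub: "descents n T \<subseteq> descents n (shift (\<lambda>p. - delta a p) T)"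
  show "\<forall>q\<in>vertices n. fst a = fst q + 1 \<longrightarrow> T q \<noteq> T a"
  proof (intro ballI impI notI)
    fix q assume q: "q \<in> vertices n" "fst a = fst q + 1" "T q = T a"
    then have "(a, q) \<in> descents n T" "q \<noteq> a" using assms by (auto simp: descents_iff)
    then have "(a, q) \<in> descents n (shift (\<lambda>p. - delta a p) T)" "q \<noteq> a" using sub by auto
    then show False using q not_minus_one_Nats by (simp add: descents_iff)
  qed
qed (intro descents_lower_superset, blast)

text \<open>An arrow out of \<open>a\<close> appears only where the difference was - 1. The bound
  \<open>D\<close> is left open: it is the arrow set of the target in \<open>monotone_step\<close>
  and that of the tableau itself in \<open>free_raise\<close>.\<close>

lemma descents_raise_subset:
  assumes "\<And>q. q \<in> vertices n \<Longrightarrow> fst a = fst q + 1 \<Longrightarrow> T q = T a + 1 \<Longrightarrow> (a, q) \<in> D"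
    and "descents n T \<subseteq> D"
  shows "descents n (shift (delta a) T) \<subseteq> D"
proof clarify
  fix p q :: vertex assume pq: "(p, q) \<in> descents n (shift (delta a) T)"
  then have v: "p \<in> vertices n" "q \<in> vertices n" "fst p = fst q + 1"
    and d: "shift (delta a) T p - shift (delta a) T q \<in> \<nat>"
    by (simp_all add: descents_iff)
  have "T p - T q \<in> \<nat> \<or> (p = a \<and> T q = T a + 1)"
  proof (cases "p = a")
    case True
    then have "q \<noteq> a" using v by auto
    then have "(T p - T q) + 1 \<in> \<nat>" using d True by (simp add: algebra_simps)
    then show ?thesis using Nats_plus_one_cases True
      by (metis add.commute add_diff_cancel_right' diff_add_cancel diff_minus_eq_add)
  next
    case False
    then show ?thesis
      using d Nats_add[OF d Nats_1] by (cases "q = a") (simp_all add: algebra_simps)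
  qed
  then show "(p, q) \<in> D"
  proof
    assume "T p - T q \<in> \<nat>"
    then have "(p, q) \<in> descents n T" using v by (simp add: descents_iff)
    then show ?thesis using assms(2) by blast
  qed (use assms(1)[of q] v in simp)
qed

lemma descents_lower_subset:
  assumes "\<And>p. p \<in> vertices n \<Longrightarrow> fst p = fst a + 1 \<Longrightarrow> T p + 1 = T a \<Longrightarrow> (p, a) \<in> D"
    and "descents n T \<subseteq> D"
  shows "descents n (shift (\<lambda>p. - delta a p) T) \<subseteq> D"
proof clarify
  fix p q :: vertex assume pq: "(p, q) \<in> descents n (shift (\<lambda>p. - delta a p) T)"
  then have v: "p \<in> vertices n" "q \<in> vertices n" "fst p = fst q + 1"
    and d: "shift (\<lambda>p. - delta a p) T p - shift (\<lambda>p. - delta a p) T q \<in> \<nat>"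
    by (simp_all add: descents_iff)
  have "T p - T q \<in> \<nat> \<or> (q = a \<and> T p + 1 = T a)"
  proof (cases "q = a")
    case True
    then have "p \<noteq> a" using v by auto
    then have "(T p - T q) + 1 \<in> \<nat>" using d True by (simp add: algebra_simps)
    then have "T p - T q \<in> \<nat> \<or> T p - T q = - 1" by (rule Nats_plus_one_cases)
    then show ?thesis using True by (auto simp: algebra_simps eq_neg_iff_add_eq_0)
  next
    case False
    then show ?thesis
      using d Nats_add[OF d Nats_1] by (cases "p = a") (simp_all add: algebra_simps)
  qed
  then show "(p, q) \<in> D"
  proof
    assume "T p - T q \<in> \<nat>"
    then have "(p, q) \<in> descents n T" using v by (simp add: descents_iff)
    then show ?thesis using assms(2) by blast
  qed (use assms(1)[of p] v in simp)
qed

lemma finite_vertices: "finite (vertices n)"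
  by (rule finite_subset[of _ "{..n} \<times> {..n}"]) (auto simp: vertices_def)

text \<open>To approach a tableau with more descents monotonically, raise the largest entry that has to be
  raised (the topmost one among equals): an entry blocking it would have to be raised as well.
  Dually for lowering.\<close>

lemma monotone_step:
  assumes z: "z \<in> int_shifts n" and D: "descents n T \<subseteq> descents n (shift z T)" and "z b \<noteq> 0"
  obtains (raise) a where "0 < z a" "descents n T \<subseteq> descents n (shift (delta a) T)"
      "descents n (shift (delta a) T) \<subseteq> descents n (shift z T)"
  | (lower) a where "z a < 0" "descents n T \<subseteq> descents n (shift (\<lambda>p. - delta a p) T)"
      "descents n (shift (\<lambda>p. - delta a p) T) \<subseteq> descents n (shift z T)"
proof -
  have supp: "a \<in> vertices n" if "z a \<noteq> 0" for a
    using z that unfolding int_shifts_def by blast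
  \<comment> \<open>An arrow with difference 0 has to survive in the target, so its source is moved
    up at least as far as its end.\<close>
  have diff: "z q \<le> z p" if "(p, q) \<in> descents n T" "T p = T q" for p q
  proof -
    have "(p, q) \<in> descents n (shift z T)" using that D by blast
    then have "(of_int (z p - z q) :: complex) \<in> \<nat>"
      using that(2) by (simp add: descents_iff)
    then show ?thesis unfolding of_int_in_Nats_iff by simp
  qed
  show ?thesis
  proof (cases "\<exists>a. 0 < z a")
    case True
    let ?P = "{a. 0 < z a}"
    have "finite ?P" by (rule finite_subset[OF _ finite_vertices[of n]]) (use supp in auto)
    then obtain a where a: "0 < z a" and
      max: "\<And>b. 0 < z b \<Longrightarrow> Re (T b) < Re (T a) \<or> (Re (T b) = Re (T a) \<and> fst b \<le> fst a)"
      using lexicographic_maximum[of ?P "\<lambda>a. Re (T a)" "\<lambda>a. int (fst a)"] True by auto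
    have av: "a \<in> vertices n" using supp a by simp
    have "descents n T \<subseteq> descents n (shift (delta a) T)"
    proof (rule descents_raise_superset, rule notI)
      fix p assume p: "p \<in> vertices n" "fst p = fst a + 1" "T p = T a"
      then have "z a \<le> z p" using av by (intro diff) (simp_all add: descents_iff)
      then show False using max[of p] a p by simp
    qed
    moreover have "descents n (shift (delta a) T) \<subseteq> descents n (shift z T)"
    proof (rule descents_raise_subset[OF _ D])
      \<comment> \<open>An entry larger than that at \<open>a\<close> is not to be raised, so the
        target difference - 1 + z a - z q is nonnegative: the new arrow already belongs to the
        target.\<close>
      fix q assume q: "q \<in> vertices n" "fst a = fst q + 1" "T q = T a + 1"
      then have "\<not> 0 < z q" using max[of q] by auto
      then have "(of_int (z a - z q - 1) :: complex) \<in> \<nat>"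
        using a unfolding of_int_in_Nats_iff by linarith
      then show "(a, q) \<in> descents n (shift z T)"
        using q av by (simp add: descents_iff algebra_simps)
    qed
    ultimately show ?thesis using raise a by blast
  next
    case False
    let ?P = "{a. z a < 0}"
    have "z b < 0" using False \<open>z b \<noteq> 0\<close> by (meson linorder_neqE_linordered_idom)
    then have ne: "?P \<noteq> {}" by blast
    have "finite ?P" by (rule finite_subset[OF _ finite_vertices[of n]]) (use supp in auto)
    \<comment> \<open>Negating both keys selects the smallest entry to be lowered, the bottommost
      one among equals.\<close>
    then obtain a where a: "z a < 0" and
      max: "\<And>b. z b < 0 \<Longrightarrow> Re (T a) < Re (T b) \<or> (Re (T b) = Re (T a) \<and> fst a \<le> fst b)"
      using lexicographic_maximum[of ?P "\<lambda>a. - Re (T a)" "\<lambda>a. - int (fst a)"] ne by auto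
    have av: "a \<in> vertices n" using supp a by simp
    have "descents n T \<subseteq> descents n (shift (\<lambda>p. - delta a p) T)"
    proof (rule descents_lower_superset, rule notI)
      fix q assume q: "q \<in> vertices n" "fst a = fst q + 1" "T q = T a"
      then have "z q \<le> z a" using av by (intro diff) (simp_all add: descents_iff)
      then show False using max[of q] a q by simp
    qed
    moreover have "descents n (shift (\<lambda>p. - delta a p) T) \<subseteq> descents n (shift z T)"
    proof (rule descents_lower_subset[OF _ D])
      fix p assume p: "p \<in> vertices n" "fst p = fst a + 1" "T p + 1 = T a"
      then have "Re (T p) + 1 = Re (T a)" by (metis one_complex.simps(1) plus_complex.simps(1))
      then have "\<not> z p < 0" using max[of p] by auto
      then have "(of_int (z p - z a - 1) :: complex) \<in> \<nat>"
        using a unfolding of_int_in_Nats_iff by linarith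
      then show "(p, a) \<in> descents n (shift z T)"
        using p av by (simp add: descents_iff algebra_simps flip: p(3))
    qed
    ultimately show ?thesis using lower a by blast
  qed
qed

section \<open>Unit steps that stay in the basis\<close>

context relation_setting
begin

text \<open>The lower bound keeps the downward arrows of \<open>G\<close> satisfied. An upward arrow
  of \<open>G\<close> fails only if the reversed arrow appears, which the upper bound
  \<open>X\<close> excludes. Row n never moves, so arrows within it are unaffected.\<close>

lemma basis_sandwich:
  assumes T: "T \<in> B" and X: "X \<in> B" and z: "z \<in> int_shifts n"
    and TU: "descents n T \<subseteq> descents n (shift z T)" and UX: "descents n (shift z T) \<subseteq> descents n X"
  shows "shift z T \<in> B"
  unfolding basis_shift_iff[OF T z] satisfies_iff
proof (intro allI impI conjI)
  fix p q assume pq: "(p, q) \<in> G"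
  note v = arrow_vertices[OF pq]
  {
    assume up: "fst q = fst p + 1"
    have "X p - X q \<in> \<nat> - {0}" using basis_satisfies[OF X] pq up unfolding satisfies_iff by blast
    then have "(q, p) \<notin> descents n X"
      using Nats_antisym[of "X p - X q"] by (auto simp: descents_iff)
    then have "(q, p) \<notin> descents n (shift z T)" using UX by blast
    then have "shift z T q - shift z T p \<notin> \<nat>" using v up by (simp add: descents_iff)
    moreover have "shift z T p - shift z T q \<in> \<int>"
    proof -
      have "T p - T q \<in> \<int>"
        using basis_satisfies[OF T] pq up Nats_imp_Ints unfolding satisfies_iff by blast
      then show ?thesis
        using Ints_add_of_int_iff[of "T p - T q" "z p - z q"] by (simp add: algebra_simps)
    qed
    ultimately show "shift z T p - shift z T q \<in> \<nat> - {0}"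
      by (intro Ints_pos_cases) simp_all
  next
    assume nup: "fst q \<noteq> fst p + 1"
    have Tpq: "T p - T q \<in> \<nat>" using basis_satisfies[OF T] pq nup unfolding satisfies_iff by blast
    show "shift z T p - shift z T q \<in> \<nat>"
    proof (cases "fst p = fst q + 1")
      case True
      then have "(p, q) \<in> descents n T" using v Tpq by (simp add: descents_iff)
      then have "(p, q) \<in> descents n (shift z T)" using TU by blast
      then show ?thesis by (simp add: descents_iff)
    next
      case False
      then have "fst p = n" "fst q = n" using arrow_rows[OF pq] nup by auto
      then show ?thesis using Tpq int_shifts_outside[OF z] by simp
    qed
  }
qed

text \<open>Raising an entry \<open>x\<close> of row \<open>m\<close> creates a new descent only if row \<open>m - 1\<close> contains
  \<open>x + 1\<close>, which then has to be raised first. That entry cannot be blocked from above: a second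
  \<open>x + 1\<close> in row \<open>m\<close> would force an \<open>x\<close> in row \<open>m + 1\<close>.\<close>

lemma free_raise:
  assumes T: "T \<in> B" and "m + 1 < n" and "i \<in> {1..m}"
    and "\<And>j. j \<in> {1..m + 1} \<Longrightarrow> T (m + 1, j) \<noteq> T (m, i)"
  shows "\<exists>z\<in>int_shifts n. (\<forall>p. m \<le> fst p \<longrightarrow> z p = 0) \<and> descents n (shift z T) = descents n T \<and>
    descents n (shift (\<lambda>p. z p + delta (m, i) p) T) = descents n T"
  using assms(2-)
proof (induction m arbitrary: i)
  case 0
  then show ?case by simp
next
  case (Suc m)
  let ?a = "(Suc m, i)"
  have a: "?a \<in> vertices n" using Suc.prems by (simp add: vertices_def)
  \<comment> \<open>Stated for a general \<open>V\<close>, because the final step may be taken after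
    rows below have been changed.\<close>
  have raise: "descents n (shift (delta ?a) V) = descents n V"
    if above: "\<And>j. V (Suc m + 1, j) = T (Suc m + 1, j)" and same: "V ?a = T ?a"
      and below: "\<And>q. q \<in> {1..m} \<Longrightarrow> V (m, q) \<noteq> V ?a + 1" for V
  proof
    show "descents n (shift (delta ?a) V) \<subseteq> descents n V"
      by (rule descents_raise_subset) (use below in \<open>auto simp: vertices_def\<close>)
    show "descents n V \<subseteq> descents n (shift (delta ?a) V)"
      by (rule descents_raise_superset)
        (use Suc.prems(3) above same in \<open>auto simp: vertices_def\<close>)
  qed
  show ?case
  proof (cases "\<exists>q\<in>{1..m}. T (m, q) = T ?a + 1")
    case False
    then have "descents n (shift (delta ?a) T) = descents n T"
      by (intro raise) auto
    then have "descents n (shift (\<lambda>p. 0 + delta ?a p) T) = descents n T" by simp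
    moreover have "(\<lambda>p. 0) \<in> int_shifts n" by (simp add: int_shifts_def)
    ultimately show ?thesis
      using shift_zero[of T] by (intro bexI[of _ "\<lambda>p. 0"] conjI) (simp_all only:, simp_all)
  next
    case True
    then obtain q where q: "q \<in> {1..m}" "T (m, q) = T ?a + 1" by blast
    have "T (m + 1, j) \<noteq> T (m, q)" if j: "j \<in> {1..m + 1}" for j
    proof
      assume "T (m + 1, j) = T (m, q)"
      then have "T (Suc m, j) = T (Suc m, i) + 1" using q by simp
      then obtain p where "p \<in> {1..Suc m + 1}" "T (Suc m + 1, p) = T (Suc m, i)"
        using row_gap[OF T, of "Suc m" j i] Suc.prems j by auto
      then show False using Suc.prems(3) by blast
    qed
    then have "\<exists>z\<in>int_shifts n. (\<forall>p. m \<le> fst p \<longrightarrow> z p = 0) \<and> descents n (shift z T) = descents n T \<and>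
        descents n (shift (\<lambda>p. z p + delta (m, q) p) T) = descents n T"
      using q(1) Suc.prems(1) by (intro Suc.IH) simp_all
    then obtain z where z: "z \<in> int_shifts n" "\<forall>p. m \<le> fst p \<longrightarrow> z p = 0"
      "descents n (shift (\<lambda>p. z p + delta (m, q) p) T) = descents n T"
      by blast
    let ?z = "\<lambda>p. z p + delta (m, q) p"
    let ?V = "shift ?z T"
    have "descents n (shift (delta ?a) ?V) = descents n ?V"
    proof (rule raise)
      \<comment> \<open>With x the entry at \<open>?a\<close>, no x + 1 is left in row m: the entry
        at q is now x + 2, and the others were different from x + 1 by
        \<open>row_distinct\<close>.\<close>
      fix q' assume q': "q' \<in> {1..m}"
      show "?V (m, q') \<noteq> ?V ?a + 1"
      proof (cases "q' = q")
        case True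
        then show ?thesis using z q by simp
      next
        case False
        then have "T (m, q') \<noteq> T (m, q)"
          using row_distinct[OF T _ q' q(1)] Suc.prems by auto
        then show ?thesis using False z q by simp
      qed
    qed (use z in simp_all)
    moreover have "shift (delta ?a) ?V = shift (\<lambda>p. ?z p + delta ?a p) T"
      by (simp add: shift_shift)
    moreover have "?z \<in> int_shifts n"
      using q Suc.prems by (intro int_shifts_add z delta_int_shifts) (auto simp: vertices_def)
    moreover have "\<forall>p. Suc m \<le> fst p \<longrightarrow> ?z p = 0" using z by (auto simp: delta_def)
    ultimately show ?thesis using z(3) by (intro bexI[of _ ?z] conjI) (simp_all only:)
  qed
qed

end

section \<open>Separating tableaux by their rows\<close>

text \<open>Vieta for the two leading coefficients, the ones that cancel between monic products with
  equally many factors and equal root sums.\<close>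

lemma coeff_monic_product:
  fixes a :: "nat \<Rightarrow> complex"
  defines "P \<equiv> \<lambda>m. \<Prod>j=1..m. [:- a j, 1:]"
  shows "m < i \<Longrightarrow> coeff (P m) i = 0" and "coeff (P m) m = 1"
    and "coeff (P (Suc m)) m = - (\<Sum>j=1..Suc m. a j)"
proof -
  have step: "coeff (P (Suc m)) (Suc i) = coeff (P m) i - a (Suc m) * coeff (P m) (Suc i)" for m i
    by (simp add: P_def coeff_pCons)
  have step0: "coeff (P (Suc m)) 0 = - a (Suc m) * coeff (P m) 0" for m
    by (simp add: P_def)
  have high: "m < i \<Longrightarrow> coeff (P m) i = 0" for m i
  proof (induction m arbitrary: i)
    case 0
    then show ?case by (simp add: P_def)
  next
    case (Suc m)
    then show ?case using step[of m "i - 1"] by simp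
  qed
  have lead: "coeff (P m) m = 1" for m
  proof (induction m)
    case 0
    then show ?case by (simp add: P_def)
  next
    case (Suc m)
    then show ?case using step[of m m] high[of m "Suc m"] by simp
  qed
  show "m < i \<Longrightarrow> coeff (P m) i = 0" and "coeff (P m) m = 1" by (fact high lead)+
  show "coeff (P (Suc m)) m = - (\<Sum>j=1..Suc m. a j)"
  proof (induction m)
    case 0
    then show ?case by (simp add: P_def)
  next
    case (Suc m)
    then show ?case using step[of "Suc m" m] lead[of "Suc m"] by simp
  qed
qed

text \<open>If nonzero, the difference of the two polynomials would have degree below k but at least
  k zeros. Comparing zeros loses multiplicities, which is harmless for rows with distinct
  entries.\<close>

lemma monic_product_eqI:
  fixes a b :: "nat \<Rightarrow> complex"
  assumes sum: "(\<Sum>j=1..Suc k. a j) = (\<Sum>j=1..Suc k. b j)"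
    and X: "finite X" "k \<le> card X"
    and eq: "\<And>x. x \<in> X \<Longrightarrow> (\<Prod>j=1..Suc k. x - a j) = (\<Prod>j=1..Suc k. x - b j)"
  shows "a ` {1..Suc k} = b ` {1..Suc k}"
proof -
  define P where "P c = (\<Prod>j=1..Suc k. [:- c j, 1:])" for c :: "nat \<Rightarrow> complex"
  have poly: "poly (P c) x = (\<Prod>j=1..Suc k. x - c j)" for c x
    unfolding P_def poly_prod by (intro prod.cong) simp_all
  define g where "g = P a - P b"
  have coeff: "coeff g i = 0" if i: "k \<le> i" for i
  proof -
    consider "i = k" | "i = Suc k" | "Suc k < i" using i by linarith
    then show ?thesis
    proof cases
      case 1
      show ?thesis
        unfolding 1 g_def P_def coeff_diff coeff_monic_product(3) sum by simp
    next
      case 2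
      show ?thesis
        unfolding 2 g_def P_def coeff_diff coeff_monic_product(2) by simp
    next
      case 3
      show ?thesis
        unfolding g_def P_def coeff_diff coeff_monic_product(1)[OF 3] by simp
    qed
  qed
  have "g = 0"
  proof (rule ccontr)
    assume "g \<noteq> 0"
    then have "degree g < k" using coeff[of "degree g"] leading_coeff_neq_0[of g] by force
    moreover have "X \<subseteq> {x. poly g x = 0}" using eq by (auto simp: g_def poly)
    then have "card X \<le> card {x. poly g x = 0}"
      using poly_roots_finite[OF \<open>g \<noteq> 0\<close>] by (intro card_mono)
    moreover have "card {x. poly g x = 0} \<le> degree g" using \<open>g \<noteq> 0\<close> by (rule card_poly_roots_bound)
    ultimately show False using X by simp
  qed
  then have "P a = P b" by (simp add: g_def)
  moreover have "c ` {1..Suc k} = {x. poly (P c) x = 0}" for c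
    unfolding poly prod_zero_iff[OF finite_atLeastAtMost] by auto
  ultimately show ?thesis by simp
qed

definition agree :: "nat \<Rightarrow> tableau \<Rightarrow> tableau \<Rightarrow> bool" where
  "agree k T U \<longleftrightarrow> (\<forall>p. fst p \<le> k \<longrightarrow> T p = U p)"

lemma agreeD: "agree k T U \<Longrightarrow> i \<le> k \<Longrightarrow> T (i, j) = U (i, j)"
  by (simp add: agree_def)

lemma agree_refl [simp]: "agree k T T"
  by (simp add: agree_def)

lemma agree_shift: "agree k T U \<Longrightarrow> agree k (shift z T) (shift z U)"
  by (simp add: agree_def)

lemma agree_shift_iff:
  "agree k T U \<Longrightarrow> agree k (shift z T) (shift w U) \<longleftrightarrow> (\<forall>p. fst p \<le> k \<longrightarrow> z p = w p)"
  by (simp add: agree_def)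

text \<open>Different unit steps are visible in the first k rows as soon as the moved row is one of
  them; projecting to one class thus isolates one term of a Gelfand-Tsetlin sum.\<close>

lemma agree_shift_delta_iff:
  assumes "agree k T U" "m \<le> k"
  shows "agree k (shift (delta (m, i)) T) (shift (delta (m, j)) U) \<longleftrightarrow> i = j"
    and "agree k (shift (\<lambda>p. - delta (m, i) p) T) (shift (\<lambda>p. - delta (m, j) p) U) \<longleftrightarrow> i = j"
proof -
  have "(\<forall>p. fst p \<le> k \<longrightarrow> delta (m, i) p = delta (m, j) p) \<longleftrightarrow> i = j"
  proof
    assume "\<forall>p. fst p \<le> k \<longrightarrow> delta (m, i) p = delta (m, j) p"
    from this[rule_format, of "(m, i)"] have "delta (m, i) (m, i) = delta (m, j) (m, i)"
      using assms(2) by (simp only: fst_conv)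
    then show "i = j" by (simp add: delta_def split: if_splits)
  qed simp
  then show "agree k (shift (delta (m, i)) T) (shift (delta (m, j)) U) \<longleftrightarrow> i = j"
    and "agree k (shift (\<lambda>p. - delta (m, i) p) T) (shift (\<lambda>p. - delta (m, j) p) U) \<longleftrightarrow> i = j"
    unfolding agree_shift_iff[OF assms(1)] by simp_all
qed

lemma ball_row_iff: "k \<le> n \<Longrightarrow> (\<forall>p\<in>vertices n. fst p = k \<longrightarrow> P p) \<longleftrightarrow> (\<forall>j\<in>{1..k}. P (k, j))"
  by (fastforce simp: vertices_def)

section \<open>Gelfand-Tsetlin coefficients and the projection to single terms\<close>

definition row_value :: "nat \<Rightarrow> tableau \<Rightarrow> complex \<Rightarrow> complex" where
  "row_value k T x = (\<Prod>j=1..k. x - T (k, j))"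

definition vandermonde :: "nat \<Rightarrow> tableau \<Rightarrow> nat \<Rightarrow> complex" where
  "vandermonde k T i = (\<Prod>j\<in>{1..k} - {i}. T (k, i) - T (k, j))"

text \<open>The minus sign of the formula stays outside, see \<open>gt_raise_eq\<close>.\<close>

definition raise_coeff :: "nat \<Rightarrow> tableau \<Rightarrow> nat \<Rightarrow> complex" where
  "raise_coeff k T i = row_value (k + 1) T (T (k, i)) / vandermonde k T i"

definition lower_coeff :: "nat \<Rightarrow> tableau \<Rightarrow> nat \<Rightarrow> complex" where
  "lower_coeff k T i = row_value (k - 1) T (T (k, i)) / vandermonde k T i"

lemma gt_raise_eq:
  "gt_raise B k T =
    - (\<Sum>i = 1..k. scale (raise_coeff k T i) (tab_in B (shift (delta (k, i)) T)))"
  by (simp add: gt_raise_def raise_coeff_def row_value_def vandermonde_def shift_delta)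

lemma gt_lower_eq:
  "gt_lower B k T =
    (\<Sum>i = 1..k. scale (lower_coeff k T i) (tab_in B (shift (\<lambda>p. - delta (k, i) p) T)))"
  by (simp add: gt_lower_def lower_coeff_def row_value_def vandermonde_def shift_minus_delta)

lemma row_value_eq_0_iff: "row_value k T x = 0 \<longleftrightarrow> (\<exists>j\<in>{1..k}. T (k, j) = x)"
  by (auto simp: row_value_def)

lemma vandermonde_cong: "(\<And>j. T (k, j) = U (k, j)) \<Longrightarrow> vandermonde k T i = vandermonde k U i"
  by (simp add: vandermonde_def)

lemma part_tab_in: "part P (tab_in B S) = (if P S then tab_in B S else 0)"
  by (cases "S \<in> B") (simp_all add: part_def)

lemma part_gt_raise:
  assumes "agree k T S" "m \<le> k" "i \<in> {1..m}"
  shows "part (agree k (shift (delta (m, i)) T)) (gt_raise B m S) =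
    scale (- raise_coeff m S i) (tab_in B (shift (delta (m, i)) S))"
proof -
  have "part (agree k (shift (delta (m, i)) T)) (gt_raise B m S) =
      - (\<Sum>j = 1..m. scale (raise_coeff m S j)
          (part (agree k (shift (delta (m, i)) T)) (tab_in B (shift (delta (m, j)) S))))"
    unfolding gt_raise_eq
    by (simp add: part_def linear_extension_uminus linear_extension_sum linear_extension_scale)
  also have "\<dots> = - (\<Sum>j = 1..m. if j = i
      then scale (raise_coeff m S i) (tab_in B (shift (delta (m, i)) S)) else 0)"
    unfolding part_tab_in agree_shift_delta_iff(1)[OF assms(1,2)]
    by (intro arg_cong[of _ _ uminus] sum.cong) auto
  finally show ?thesis using assms(3) by (simp add: scale_minus_left)
qed

lemma part_gt_lower:
  assumes "agree k T S" "m \<le> k" "i \<in> {1..m}"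
  shows "part (agree k (shift (\<lambda>p. - delta (m, i) p) T)) (gt_lower B m S) =
    scale (lower_coeff m S i) (tab_in B (shift (\<lambda>p. - delta (m, i) p) S))"
proof -
  have "part (agree k (shift (\<lambda>p. - delta (m, i) p) T)) (gt_lower B m S) =
      (\<Sum>j = 1..m. scale (lower_coeff m S j)
          (part (agree k (shift (\<lambda>p. - delta (m, i) p) T)) (tab_in B (shift (\<lambda>p. - delta (m, j) p) S))))"
    unfolding gt_lower_eq
    by (simp add: part_def linear_extension_sum linear_extension_scale)
  also have "\<dots> = (\<Sum>j = 1..m. if j = i
      then scale (lower_coeff m S i) (tab_in B (shift (\<lambda>p. - delta (m, i) p) S)) else 0)"
    unfolding part_tab_in agree_shift_delta_iff(2)[OF assms(1,2)]
    by (intro sum.cong) auto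
  finally show ?thesis using assms(3) by simp
qed

section \<open>Separation of tableaux by induction over the rows\<close>

context relation_setting
begin

lemma vandermonde_nonzero: "T \<in> B \<Longrightarrow> k < n \<Longrightarrow> i \<in> {1..k} \<Longrightarrow> vandermonde k T i \<noteq> 0"
  unfolding vandermonde_def using row_distinct[of T k i] by (force simp: prod_zero_iff)

text \<open>The denominator is nonzero, so the coefficient vanishes exactly with its numerator. A
  zero factor is an entry of row k + 1 equal to the raised one, that is, a downward arrow with
  difference 0.\<close>

lemma raise_coeff_nonzero:
  assumes "T \<in> B" "k < n" "i \<in> {1..k}"
  shows "raise_coeff k T i \<noteq> 0 \<longleftrightarrow> descents n T \<subseteq> descents n (shift (delta (k, i)) T)"
proof -
  have "(k, i) \<in> vertices n" using assms by (simp add: vertices_def)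
  then have "descents n T \<subseteq> descents n (shift (delta (k, i)) T) \<longleftrightarrow>
      (\<forall>j\<in>{1..k + 1}. T (k + 1, j) \<noteq> T (k, i))"
    unfolding descents_raise_superset_iff[OF \<open>(k, i) \<in> vertices n\<close>] fst_conv
    using assms(2) by (intro ball_row_iff) simp
  then show ?thesis
    using vandermonde_nonzero[OF assms] by (simp add: raise_coeff_def row_value_eq_0_iff)
qed

lemma lower_coeff_nonzero:
  assumes "T \<in> B" "k < n" "i \<in> {1..k}"
  shows "lower_coeff k T i \<noteq> 0 \<longleftrightarrow> descents n T \<subseteq> descents n (shift (\<lambda>p. - delta (k, i) p) T)"
proof -
  have "(k, i) \<in> vertices n" using assms by (simp add: vertices_def)
  have row: "k = fst q + 1 \<longleftrightarrow> fst q = k - 1" for q :: vertex using assms(3) by auto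
  have "descents n T \<subseteq> descents n (shift (\<lambda>p. - delta (k, i) p) T) \<longleftrightarrow>
      (\<forall>j\<in>{1..k - 1}. T (k - 1, j) \<noteq> T (k, i))"
    unfolding descents_lower_superset_iff[OF \<open>(k, i) \<in> vertices n\<close>] fst_conv row
    using assms(2) by (intro ball_row_iff) simp
  then show ?thesis
    using vandermonde_nonzero[OF assms] by (simp add: lower_coeff_def row_value_eq_0_iff)
qed

text \<open>An arrow of \<open>G\<close> joins either rows up to k, where \<open>S\<close> and
  \<open>T\<close> agree, or rows from k on, where nothing moves; each inequality is inherited from
  the shifted \<open>T\<close> or from \<open>S\<close>.\<close>

lemma basis_transfer:
  assumes T: "T \<in> B" and S: "S \<in> B" and TS: "agree k T S" and z: "z \<in> int_shifts n"
    and low: "\<And>p. k \<le> fst p \<Longrightarrow> z p = 0" and TB: "shift z T \<in> B"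
  shows "shift z S \<in> B"
proof -
  have "shift z S p - shift z S q = shift z T p - shift z T q \<or>
      shift z S p - shift z S q = S p - S q" if pq: "(p, q) \<in> G" for p q
  proof (cases "fst p \<le> k \<and> fst q \<le> k")
    case True
    then have "T p = S p" "T q = S q" using TS unfolding agree_def by blast+
    then show ?thesis by simp
  next
    case False
    then have "k \<le> fst p" "k \<le> fst q" using arrow_rows[OF pq] by auto
    then show ?thesis using low by simp
  qed
  then show ?thesis
    using basis_satisfies[OF S] basis_satisfies[OF TB]
    unfolding basis_shift_iff[OF S z] satisfies_iff by metis
qed

text \<open>Invariance under gl(k) alone: passing from k to k + 1 adds raising and lowering in row k
  and the diagonal operator of k + 1.\<close>

definition stable :: "nat \<Rightarrow> gt_vector set \<Rightarrow> bool" where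
  "stable k W \<longleftrightarrow> linear_subspace W \<and> W \<subseteq> tableau_span B \<and>
    (\<forall>m\<in>{1..<k}. \<forall>v\<in>W.
      linear_extension (gt_raise B m) v \<in> W \<and> linear_extension (gt_lower B m) v \<in> W) \<and>
    (\<forall>m\<in>{1..k}. \<forall>v\<in>W. linear_extension (gt_diag m) v \<in> W)"

lemma stable_subspace: "stable k W \<Longrightarrow> linear_subspace W"
  and stable_keys: "stable k W \<Longrightarrow> v \<in> W \<Longrightarrow> T \<in> Poly_Mapping.keys v \<Longrightarrow> T \<in> B"
  and stable_raise: "stable k W \<Longrightarrow> m \<in> {1..<k} \<Longrightarrow> v \<in> W \<Longrightarrow> linear_extension (gt_raise B m) v \<in> W"
  and stable_lower: "stable k W \<Longrightarrow> m \<in> {1..<k} \<Longrightarrow> v \<in> W \<Longrightarrow> linear_extension (gt_lower B m) v \<in> W"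
  and stable_diag: "stable k W \<Longrightarrow> m \<in> {1..k} \<Longrightarrow> v \<in> W \<Longrightarrow> linear_extension (gt_diag m) v \<in> W"
  unfolding stable_def tableau_span_def by blast+

lemma stable_mono: "stable k W \<Longrightarrow> l \<le> k \<Longrightarrow> stable l W"
  unfolding stable_def by fastforce

text \<open>The counterpart of decomposing \<open>W\<close> by characters of the Gelfand-Tsetlin
  subalgebra of gl(k); the first k rows take the place of the character.\<close>

definition separating :: "nat \<Rightarrow> gt_vector set \<Rightarrow> bool" where
  "separating k W \<longleftrightarrow> stable k W \<and> (\<forall>v\<in>W. \<forall>T\<in>B. part (agree k T) v \<in> W)"

text \<open>The projection isolates the term moving \<open>a\<close>. Its coefficient involves only
  rows up to k, so all tableaux in \<open>v\<close> share it; it is nonzero because no arrow is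
  lost, and can be divided out.\<close>

lemma separating_raise:
  assumes W: "separating k W" and k: "k \<le> n" and T: "T \<in> B" and a: "a \<in> vertices n" "fst a < k"
    and TB: "shift (delta a) T \<in> B" and D: "descents n T \<subseteq> descents n (shift (delta a) T)"
    and v: "v \<in> W" "\<And>S. S \<in> Poly_Mapping.keys v \<Longrightarrow> agree k T S"
  shows "linear_extension (\<lambda>S. tab (shift (delta a) S)) v \<in> W"
proof -
  obtain m i where mi: "a = (m, i)" by (cases a)
  have m: "m < k" "m < n" "i \<in> {1..m}" "m \<in> {1..<k}"
    using a k by (auto simp: mi vertices_def)
  have st: "stable k W" using W by (simp add: separating_def)
  define c where "c = - raise_coeff m T i"
  have "c \<noteq> 0" using raise_coeff_nonzero[OF T m(2,3)] D by (simp add: c_def mi)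
  let ?u = "part (agree k (shift (delta a) T)) (linear_extension (gt_raise B m) v)"
  have "?u \<in> W" using W stable_raise[OF st m(4) v(1)] TB by (simp add: separating_def)
  moreover have "?u = linear_extension (\<lambda>S. scale c (tab (shift (delta a) S))) v"
    unfolding part_linear_extension
  proof (rule linear_extension_cong)
    fix S assume S: "S \<in> Poly_Mapping.keys v"
    have "S \<in> B" using stable_keys[OF st v(1) S] .
    moreover have "delta a p = 0" if "k \<le> fst p" for p using that a by (auto simp: delta_def)
    ultimately have "shift (delta a) S \<in> B"
      using basis_transfer[OF T _ v(2)[OF S] delta_int_shifts[OF a(1)] _ TB] a k by simp
    moreover have "raise_coeff m S i = raise_coeff m T i"
      using v(2)[OF S] m
      by (simp add: raise_coeff_def row_value_def vandermonde_def agree_def)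
    ultimately show "part (agree k (shift (delta a) T)) (gt_raise B m S) =
        scale c (tab (shift (delta a) S))"
      using part_gt_raise[OF v(2)[OF S], of m i B] m by (simp add: mi c_def)
  qed
  ultimately have "scale (1 / c) (linear_extension (\<lambda>S. scale c (tab (shift (delta a) S))) v) \<in> W"
    using linear_subspace_scale[OF stable_subspace[OF st]] by metis
  then show ?thesis
    using \<open>c \<noteq> 0\<close> by (simp flip: linear_extension_scale add: linear_extension_def scale_sum mult.left_commute)
qed

lemma separating_lower:
  assumes W: "separating k W" and k: "k \<le> n" and T: "T \<in> B" and a: "a \<in> vertices n" "fst a < k"
    and TB: "shift (\<lambda>p. - delta a p) T \<in> B"
    and D: "descents n T \<subseteq> descents n (shift (\<lambda>p. - delta a p) T)"
    and v: "v \<in> W" "\<And>S. S \<in> Poly_Mapping.keys v \<Longrightarrow> agree k T S"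
  shows "linear_extension (\<lambda>S. tab (shift (\<lambda>p. - delta a p) S)) v \<in> W"
proof -
  obtain m i where mi: "a = (m, i)" by (cases a)
  have m: "m < k" "m < n" "i \<in> {1..m}" "m \<in> {1..<k}"
    using a k by (auto simp: mi vertices_def)
  have st: "stable k W" using W by (simp add: separating_def)
  define c where "c = lower_coeff m T i"
  have "c \<noteq> 0" using lower_coeff_nonzero[OF T m(2,3)] D by (simp add: c_def mi)
  let ?u = "part (agree k (shift (\<lambda>p. - delta a p) T)) (linear_extension (gt_lower B m) v)"
  have "?u \<in> W" using W stable_lower[OF st m(4) v(1)] TB by (simp add: separating_def)
  moreover have "?u = linear_extension (\<lambda>S. scale c (tab (shift (\<lambda>p. - delta a p) S))) v"
    unfolding part_linear_extension
  proof (rule linear_extension_cong)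
    fix S assume S: "S \<in> Poly_Mapping.keys v"
    have "S \<in> B" using stable_keys[OF st v(1) S] .
    moreover have "delta a p = 0" if "k \<le> fst p" for p using that a by (auto simp: delta_def)
    ultimately have "shift (\<lambda>p. - delta a p) S \<in> B"
      using basis_transfer[OF T _ v(2)[OF S] int_shifts_minus[OF delta_int_shifts[OF a(1)]] _ TB] a k
      by simp
    moreover have "lower_coeff m S i = lower_coeff m T i"
      using v(2)[OF S] m
      by (simp add: lower_coeff_def row_value_def vandermonde_def agree_def)
    ultimately show "part (agree k (shift (\<lambda>p. - delta a p) T)) (gt_lower B m S) =
        scale c (tab (shift (\<lambda>p. - delta a p) S))"
      using part_gt_lower[OF v(2)[OF S], of m i B] m by (simp add: mi c_def)
  qed
  ultimately have "scale (1 / c) (linear_extension (\<lambda>S. scale c (tab (shift (\<lambda>p. - delta a p) S))) v) \<in> W"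
    using linear_subspace_scale[OF stable_subspace[OF st]] by metis
  then show ?thesis
    using \<open>c \<noteq> 0\<close> by (simp flip: linear_extension_scale add: linear_extension_def scale_sum mult.left_commute)
qed

text \<open>Moves all tableaux of \<open>v\<close> at once along a monotone path of unit steps
  chosen for \<open>T\<close> alone; \<open>basis_sandwich\<close> keeps the path in the basis. The
  induction is on the total length of the shift.\<close>

lemma separating_shift:
  assumes W: "separating k W" and k: "k \<le> n" and T: "T \<in> B"
    and z: "z \<in> int_shifts n" "\<And>p. k \<le> fst p \<Longrightarrow> z p = 0"
    and TB: "shift z T \<in> B" and D: "descents n T \<subseteq> descents n (shift z T)"
    and v: "v \<in> W" "\<And>S. S \<in> Poly_Mapping.keys v \<Longrightarrow> agree k T S"
  shows "linear_extension (\<lambda>S. tab (shift z S)) v \<in> W"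
  using T z TB D v
proof (induction "\<Sum>p\<in>vertices n. nat \<bar>z p\<bar>" arbitrary: z T v rule: less_induct)
  case less
  note T = less.prems(1) and z = less.prems(2,3) and TB = less.prems(4) and D = less.prems(5)
    and v = less.prems(6,7)
  have supp: "a \<in> vertices n \<and> fst a < k" if "z a \<noteq> 0" for a
    using z that unfolding int_shifts_def by (metis (mono_tags, lifting) mem_Collect_eq not_less)
  \<comment> \<open>One unit step \<open>y\<close> towards \<open>z\<close>, treated for both signs
    together; the condition on absolute values says that it shortens the remaining shift at
    \<open>a\<close>.\<close>
  have smaller: ?case
    if a: "z a \<noteq> 0" and abs: "\<bar>z a - y a\<bar> < \<bar>z a\<bar>" and y: "\<And>p. p \<noteq> a \<Longrightarrow> y p = 0"
      and sub: "descents n T \<subseteq> descents n (shift y T)" "descents n (shift y T) \<subseteq> descents n (shift z T)"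
      and step: "shift y T \<in> B \<Longrightarrow> linear_extension (\<lambda>S. tab (shift y S)) v \<in> W" for a y
  proof -
    have "y \<in> int_shifts n"
    proof (rule int_shiftsI)
      show "y p = 0" if "p \<notin> vertices n" for p using y supp[OF a] that by metis
      show "y (n, i) = 0" for i using y supp[OF a] k by (metis fst_conv not_less)
    qed
    let ?T = "shift y T" and ?z = "\<lambda>p. z p - y p" and ?v = "linear_extension (\<lambda>S. tab (shift y S)) v"
    have yB: "?T \<in> B" by (rule basis_sandwich[OF T TB \<open>y \<in> int_shifts n\<close> sub])
    have eq: "shift ?z (shift y S) = shift z S" for S by (simp add: shift_shift)
    have "linear_extension (\<lambda>S. tab (shift ?z S)) ?v \<in> W"
    proof (rule less.hyps[where T = ?T and z = ?z and v = ?v])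
      show "(\<Sum>p\<in>vertices n. nat \<bar>z p - y p\<bar>) < (\<Sum>p\<in>vertices n. nat \<bar>z p\<bar>)"
      proof (rule sum_strict_mono_ex1[OF finite_vertices])
        show "\<forall>p\<in>vertices n. nat \<bar>z p - y p\<bar> \<le> nat \<bar>z p\<bar>"
        proof
          show "nat \<bar>z p - y p\<bar> \<le> nat \<bar>z p\<bar>" for p
            using abs y by (cases "p = a") auto
        qed
        show "\<exists>p\<in>vertices n. nat \<bar>z p - y p\<bar> < nat \<bar>z p\<bar>"
          using abs supp[OF a] by (intro bexI[of _ a]) auto
      qed
      show "?z \<in> int_shifts n" using z(1) \<open>y \<in> int_shifts n\<close> by (rule int_shifts_diff)
      show "\<And>p. k \<le> fst p \<Longrightarrow> ?z p = 0" using y z(2) supp[OF a]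
        by (metis diff_0_right not_less)
      show "shift ?z ?T \<in> B" unfolding eq by (rule TB)
      show "descents n ?T \<subseteq> descents n (shift ?z ?T)" unfolding eq by (rule sub(2))
      show "\<And>S. S \<in> Poly_Mapping.keys ?v \<Longrightarrow> agree k ?T S"
        using keys_linear_extension[of "\<lambda>S. tab (shift y S)" v] v(2) agree_shift by auto
    qed (use yB step in auto)
    then show ?thesis unfolding linear_extension_compose linear_extension_tab eq .
  qed
  show ?case
  proof (cases "\<exists>b. z b \<noteq> 0")
    case False
    then have "z = (\<lambda>p. 0)" by auto
    then show ?thesis using v by (simp add: shift_def)
  next
    case True
    then obtain b where "z b \<noteq> 0" by blast
    then show ?thesis
    proof (rule monotone_step[OF z(1) D])
      fix a assume a: "0 < z a" and sub: "descents n T \<subseteq> descents n (shift (delta a) T)"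
        "descents n (shift (delta a) T) \<subseteq> descents n (shift z T)"
      show ?thesis
        by (rule smaller[of a "delta a", OF _ _ _ sub])
          (use a v separating_raise[OF W k T _ _ _ sub(1)] supp in auto)
    next
      fix a assume a: "z a < 0" and sub: "descents n T \<subseteq> descents n (shift (\<lambda>p. - delta a p) T)"
        "descents n (shift (\<lambda>p. - delta a p) T) \<subseteq> descents n (shift z T)"
      show ?thesis
        by (rule smaller[of a "\<lambda>p. - delta a p", OF _ _ _ sub])
          (use a v separating_lower[OF W k T _ _ _ sub(1)] supp in auto)
    qed
  qed
qed

lemma part_raise_linear_extension:
  assumes "m \<le> k" "i \<in> {1..m}" "\<And>S. S \<in> Poly_Mapping.keys v \<Longrightarrow> agree k T (f S)"
  shows "part (agree k (shift (delta (m, i)) T)) (linear_extension (gt_raise B m)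
      (linear_extension (\<lambda>S. tab (f S)) v)) =
    linear_extension (\<lambda>S. scale (- raise_coeff m (f S) i) (tab_in B (shift (delta (m, i)) (f S)))) v"
  unfolding linear_extension_compose part_linear_extension linear_extension_tab
  using assms by (intro linear_extension_cong part_gt_raise) simp_all

text \<open>Among tableaux with the same first \<open>k\<close> rows, raising and lowering the entry \<open>x\<close> at \<open>(k, i)\<close>
  multiplies by \<open>\<Prod>\<^sub>j (x - l\<^sub>k\<^sub>+\<^sub>1\<^sub>,\<^sub>j)\<close> up to a factor depending only on these rows. The entries
  that obstruct raising are moved out of the way before, and moved back afterwards.\<close>

lemma separating_row_value:
  assumes W: "separating k W" "stable (Suc k) W" and k: "Suc k < n" and T: "T \<in> B"
    and i: "i \<in> {1..k}"
    and v: "v \<in> W" "\<And>S. S \<in> Poly_Mapping.keys v \<Longrightarrow> agree k T S"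
  shows "linear_extension (\<lambda>S. scale (row_value (Suc k) S (T (k, i))) (tab S)) v \<in> W"
proof -
  let ?x = "T (k, i)"
  let ?a = "(k, i)"
  let ?f = "\<lambda>S. row_value (Suc k) S ?x"
  let ?w = "linear_extension (\<lambda>S. scale (?f S) (tab S)) v"
  have sub: "linear_subspace W" using W(2) by (rule stable_subspace)
  show ?thesis
  proof (cases "\<exists>S\<in>Poly_Mapping.keys v. ?f S \<noteq> 0")
    case False
    then have "?w = linear_extension (\<lambda>S. 0) v" by (intro linear_extension_cong) simp
    then show ?thesis using linear_subspace_zero[OF sub] by (simp add: linear_extension_def)
  next
    case True
    \<comment> \<open>A nonzero value means that row k + 1 of \<open>T1\<close> does not contain the
      entry to be raised, as \<open>free_raise\<close> requires. The resulting shift serves all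
      tableaux of \<open>v\<close>, since it concerns only rows below k.\<close>
    then obtain T1 where T1: "T1 \<in> Poly_Mapping.keys v" "?f T1 \<noteq> 0" by blast
    have keys: "S \<in> B" "agree k T1 S" "S ?a = ?x" if "S \<in> Poly_Mapping.keys v" for S
      using stable_keys[OF W(2) v(1) that] v(2)[OF that] v(2)[OF T1(1)]
      by (auto simp: agree_def)
    have B1: "T1 \<in> B" and x: "T1 ?a = ?x" using keys T1 by auto
    have a: "?a \<in> vertices n" using i k by (simp add: vertices_def)
    have "\<exists>z\<in>int_shifts n. (\<forall>p. k \<le> fst p \<longrightarrow> z p = 0) \<and> descents n (shift z T1) = descents n T1 \<and>
        descents n (shift (\<lambda>p. z p + delta ?a p) T1) = descents n T1"
      using T1(2) i k x by (intro free_raise[OF B1]) (auto simp: row_value_eq_0_iff)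
    then obtain z where z: "z \<in> int_shifts n" "\<And>p. k \<le> fst p \<Longrightarrow> z p = 0"
      and D1: "descents n (shift z T1) = descents n T1"
      and D2: "descents n (shift (delta ?a) (shift z T1)) = descents n T1"
      unfolding shift_shift by blast
    have z': "(\<lambda>p. z p + delta ?a p) \<in> int_shifts n"
      using z(1) a k by (intro int_shifts_add delta_int_shifts) simp_all
    let ?V = "shift z T1" and ?V' = "shift (delta ?a) (shift z T1)"
    have VB: "?V \<in> B" by (rule basis_sandwich[OF B1 B1 z(1)]) (simp_all only: D1 order_refl)
    have V'B: "?V' \<in> B"
      using basis_sandwich[OF B1 B1 z'] D2 unfolding shift_shift by blast
    have SB: "shift z S \<in> B" if S: "S \<in> Poly_Mapping.keys v" for S
      by (rule basis_transfer[OF B1 keys(1,2)[OF S] z VB])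
    \<comment> \<open>\<open>basis_transfer\<close> does not cover the raised entry: row k moves,
      and row k + 1 may differ between tableaux of \<open>v\<close>. The nonzero value protects the
      arrows coming down from row k + 1.\<close>
    have S'B: "shift (delta ?a) (shift z S) \<in> B" if S: "S \<in> Poly_Mapping.keys v" and fS: "?f S \<noteq> 0" for S
      unfolding shift_shift basis_shift_iff[OF keys(1)[OF S] z'] satisfies_iff
    proof (intro allI impI)
      fix p q assume pq: "(p, q) \<in> G"
      let ?y = "\<lambda>p. z p + delta ?a p"
      let ?good = "\<lambda>X. (fst q = fst p + 1 \<longrightarrow> X p - X q \<in> \<nat> - {0}) \<and>
          (fst q \<noteq> fst p + 1 \<longrightarrow> X p - X q \<in> \<nat>)"
      have goodS: "?good S" and goodV: "?good (shift ?y T1)"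
        using basis_satisfies[OF keys(1)[OF S]] basis_satisfies[OF V'B] pq
        unfolding satisfies_iff shift_shift by blast+
      have y: "?y r = 0" if "k \<le> fst r" "r \<noteq> ?a" for r using z(2) that by simp
      consider (low) "fst p \<le> k" "fst q \<le> k" | (high) "p \<noteq> ?a" "q \<noteq> ?a" "k \<le> fst p" "k \<le> fst q"
        | (down) "q = ?a" "fst p = k + 1" | (up) "p = ?a" "fst q = k + 1"
        using arrow_rows[OF pq] k by fastforce
      then show "?good (shift ?y S)"
      proof cases
        case low
        then have "S p = T1 p" "S q = T1 q" using keys(2)[OF S] unfolding agree_def by metis+
        then have "shift ?y S p = shift ?y T1 p" "shift ?y S q = shift ?y T1 q" by simp_all
        then show ?thesis using goodV by (simp only:)
      next
        case high
        then have "shift ?y S p = S p" "shift ?y S q = S q" using y by simp_all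
        then show ?thesis using goodS by (simp only:)
      next
        case down
        have "p \<in> vertices n" using arrow_vertices[OF pq] by simp
        then have "S p \<noteq> ?x"
          using fS down(2) by (cases p) (auto simp: row_value_eq_0_iff vertices_def)
        then have "S p - S q \<noteq> 0" using keys(3)[OF S] down by simp
        moreover have "S p - S q \<in> \<nat>" using goodS down by simp
        ultimately have "S p - S q - 1 \<in> \<nat>" by (intro Nats_minus_one)
        moreover have "shift ?y S p - shift ?y S q = S p - S q - 1"
        proof -
          have "p \<noteq> ?a" using down by auto
          then show ?thesis using down z(2)[of p] z(2)[of ?a] by simp
        qed
        ultimately have "shift ?y S p - shift ?y S q \<in> \<nat>" by (simp only:)
        then show ?thesis using down by simp
      next
        case up
        have "S p - S q \<in> \<nat> - {0}" using goodS up by simp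
        then have "S p - S q + 1 \<in> \<nat> - {0}"
          by (auto elim!: Nats_cases simp flip: of_nat_Suc simp: add.commute)
        moreover have "shift ?y S p - shift ?y S q = S p - S q + 1"
        proof -
          have "q \<noteq> ?a" using up by auto
          then show ?thesis using up z(2)[of q] z(2)[of ?a] by simp
        qed
        ultimately have "shift ?y S p - shift ?y S q \<in> \<nat> - {0}" by (simp only:)
        then show ?thesis using up by simp
      qed
    qed
    define d where "d = vandermonde k T1 i"
    define c where "c = lower_coeff k ?V' i"
    have d: "d \<noteq> 0" using vandermonde_nonzero[OF B1 _ i] k by (simp add: d_def)
    \<comment> \<open>Raising added no arrow, so lowering loses none and its coefficient is
      nonzero.\<close>
    have "descents n ?V' \<subseteq> descents n (shift (\<lambda>p. - delta ?a p) ?V')"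
      using D1 D2 by (simp add: shift_shift)
    then have c: "c \<noteq> 0" unfolding c_def using lower_coeff_nonzero[OF V'B _ i] k by simp
    have kW: "k \<in> {1..<Suc k}" using i by simp
    have part: "part (agree k U) u \<in> W" if "u \<in> W" "U \<in> B" for u U
      using W(1) that by (simp add: separating_def)
    have agreeV: "agree k ?V (shift z S)" if "S \<in> Poly_Mapping.keys v" for S
      using keys(2)[OF that] by (rule agree_shift)
    define u where "u = linear_extension (\<lambda>S. tab (shift z S)) v"
    have "u \<in> W" unfolding u_def
      by (rule separating_shift[OF W(1) _ B1 z VB]) (use k D1 v(1) keys in auto)
    then have "part (agree k ?V') (linear_extension (gt_raise B k) u) \<in> W"
      using stable_raise[OF W(2) kW] V'B part by blast
    then have "part (agree k (shift (\<lambda>p. - delta ?a p) ?V')) (linear_extension (gt_lower B k)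
        (part (agree k ?V') (linear_extension (gt_raise B k) u))) \<in> W" (is "?u' \<in> W")
      using stable_lower[OF W(2) kW] VB part by (simp add: shift_shift)
    \<comment> \<open>Raising contributes the row value divided by - d, lowering contributes c. If
      the row value is 0, the term vanishes whether or not the raised tableau belongs to the
      basis.\<close>
    moreover have "?u' = scale (- c / d) (linear_extension (\<lambda>S. tab (shift z S)) ?w)"
    proof -
      have "?u' = linear_extension (\<lambda>S. part (agree k (shift (\<lambda>p. - delta ?a p) ?V'))
          (linear_extension (gt_lower B k)
            (scale (- raise_coeff k (shift z S) i) (tab_in B (shift (delta ?a) (shift z S)))))) v"
        unfolding u_def using i agreeV
        by (subst part_raise_linear_extension) (simp_all add: linear_extension_compose part_linear_extension)
      also have "\<dots> = linear_extension (\<lambda>S. scale (- c / d) (scale (?f S) (tab (shift z S)))) v"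
      proof (rule linear_extension_cong)
        fix S assume S: "S \<in> Poly_Mapping.keys v"
        have raise: "raise_coeff k (shift z S) i = ?f S / d"
        proof -
          have "vandermonde k (shift z S) i = d"
            unfolding d_def using z(2) agreeD[OF keys(2)[OF S]]
            by (intro vandermonde_cong) simp
          moreover have "row_value (k + 1) (shift z S) ?x = ?f S"
            using z(2) by (simp add: row_value_def)
          ultimately show ?thesis using z(2) keys(3)[OF S] by (simp add: raise_coeff_def)
        qed
        show "part (agree k (shift (\<lambda>p. - delta ?a p) ?V')) (linear_extension (gt_lower B k)
            (scale (- raise_coeff k (shift z S) i) (tab_in B (shift (delta ?a) (shift z S))))) =
          scale (- c / d) (scale (?f S) (tab (shift z S)))"
        proof (cases "?f S = 0")
          case True
          then show ?thesis unfolding raise by (simp add: part_def)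
        next
          case False
          let ?S' = "shift (delta ?a) (shift z S)"
          have agree': "agree k ?V' ?S'" using agreeV[OF S] by (rule agree_shift)
          have "lower_coeff k ?S' i = c"
            using agree' i by (simp add: c_def lower_coeff_def row_value_def vandermonde_def agree_def)
          moreover have "shift (\<lambda>p. - delta ?a p) ?S' = shift z S" by (simp add: shift_shift)
          ultimately have "part (agree k (shift (\<lambda>p. - delta ?a p) ?V')) (gt_lower B k ?S') =
              scale c (tab (shift z S))"
            using part_gt_lower[OF agree' order_refl i, of B] SB[OF S] by simp
          then show ?thesis unfolding raise
            using S'B[OF S False]
            by (simp add: linear_extension_scale part_def linear_extension_scale mult.commute)
        qed
      qed
      also have "\<dots> = scale (- c / d) (linear_extension (\<lambda>S. tab (shift z S)) ?w)"
        unfolding linear_extension_compose linear_extension_scale linear_extension_tab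
        unfolding linear_extension_def scale_sum by (simp add: mult_ac)
      finally show ?thesis .
    qed
    ultimately have "scale (- d / c) (scale (- c / d) (linear_extension (\<lambda>S. tab (shift z S)) ?w)) \<in> W"
      using linear_subspace_scale[OF sub] by metis
    then have shifted: "linear_extension (\<lambda>S. tab (shift z S)) ?w \<in> W" (is "?w' \<in> W")
      using c d by simp
    \<comment> \<open>The preparatory moves left the arrows of \<open>T1\<close> unchanged, so they
      can be undone in the same way.\<close>
    have "linear_extension (\<lambda>S. tab (shift (\<lambda>p. - z p) S)) ?w' \<in> W"
    proof (rule separating_shift[OF W(1) _ VB])
      show "(\<lambda>p. - z p) \<in> int_shifts n" using z(1) by (rule int_shifts_minus)
      have unshift: "shift (\<lambda>p. - z p) ?V = T1" by (simp add: shift_shift)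
      show "shift (\<lambda>p. - z p) ?V \<in> B" unfolding unshift by (rule B1)
      show "descents n ?V \<subseteq> descents n (shift (\<lambda>p. - z p) ?V)" unfolding unshift D1 by simp
      show "agree k ?V S" if S: "S \<in> Poly_Mapping.keys ?w'" for S
      proof -
        have "Poly_Mapping.keys ?w \<subseteq> Poly_Mapping.keys v"
          using keys_linear_extension[of "\<lambda>S. scale (?f S) (tab S)" v] keys_scale by fastforce
        moreover have "S \<in> shift z ` Poly_Mapping.keys ?w"
          using keys_linear_extension[of "\<lambda>S. tab (shift z S)" ?w] S by auto
        ultimately show ?thesis using agreeV by auto
      qed
    qed (use k z shifted in auto)
    then show ?thesis
      by (simp add: linear_extension_compose[of _ "\<lambda>S. tab (shift z S)"] shift_shift)
  qed
qed

text \<open>The k evaluation points are distinct by \<open>row_distinct\<close>, so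
  \<open>monic_product_eqI\<close> gives equal sets of values in row k + 1; \<open>row_eqI\<close>
  turns these into equal rows.\<close>

lemma agree_SucI:
  assumes "T \<in> B" "U \<in> B" "Suc k < n" "agree k T U"
    and sum: "(\<Sum>j=1..Suc k. T (Suc k, j)) = (\<Sum>j=1..Suc k. U (Suc k, j))"
    and val: "\<And>i. i \<in> {1..k} \<Longrightarrow> row_value (Suc k) T (T (k, i)) = row_value (Suc k) U (T (k, i))"
  shows "agree (Suc k) T U"
proof -
  have "card ((\<lambda>i. T (k, i)) ` {1..k}) = k"
    using row_distinct[OF assms(1), of k] assms(3) by (subst card_image) (auto intro!: inj_onI)
  then have "(\<lambda>j. T (Suc k, j)) ` {1..Suc k} = (\<lambda>j. U (Suc k, j)) ` {1..Suc k}"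
    using val sum
    by (intro monic_product_eqI[where X = "(\<lambda>i. T (k, i)) ` {1..k}"]) (auto simp: row_value_def)
  then have "T (Suc k, j) = U (Suc k, j)" for j
    using row_eqI[OF assms(1,2,3)] by blast
  then show ?thesis
    using assms(4) unfolding agree_def by (metis le_Suc_eq prod.collapse)
qed

text \<open>Inside a class with fixed first k rows, row k + 1 is cut out by diagonal operators:
  E_{k+1,k+1} and the k multiplications from \<open>separating_row_value\<close>.
  \<open>eigen_component\<close> is applied to one after the other.\<close>

theorem separation: "k \<le> n \<Longrightarrow> stable k W \<Longrightarrow> separating k W"
proof (induction k)
  case 0
  \<comment> \<open>Row 0 lies outside the triangle, where all basis tableaux agree, so there is a
    single class.\<close>
  have "part (agree 0 U) v = v" if "v \<in> W" "U \<in> B" for v U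
    using stable_keys[OF 0(2) that(1)] basis_outside[OF that(2)]
    by (intro part_self) (auto simp: agree_def vertices_def)
  then show ?case using 0 by (simp add: separating_def)
next
  case (Suc k)
  have st: "stable k W" using Suc.prems(2) by (rule stable_mono) simp
  have sep: "separating k W" using Suc.IH[OF _ st] Suc.prems(1) by simp
  have sub: "linear_subspace W" using st by (rule stable_subspace)
  note keysB = stable_keys[OF st]
  have "part (agree (Suc k) U) v \<in> W" if v: "v \<in> W" and U: "U \<in> B" for v U
  proof -
    have v1: "part (agree k U) v \<in> W" (is "?v \<in> W") using sep v U by (simp add: separating_def)
    show ?thesis
    proof (cases "Suc k = n")
      \<comment> \<open>The top row is common to all basis tableaux, so the classes do not change in
        the last step.\<close>
      case True
      have "agree (Suc k) U T \<longleftrightarrow> agree k U T" if "T \<in> Poly_Mapping.keys v" for T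
        using basis_outside[OF U keysB[OF v that]] True unfolding agree_def
        by (metis le_Suc_eq)
      then have "part (agree (Suc k) U) v = ?v" by (rule part_cong)
      then show ?thesis using v1 by simp
    next
      case False
      then have k: "Suc k < n" using Suc.prems(1) by simp
      let ?F = "{T \<in> B. agree k U T}"
      \<comment> \<open>The eigenvalue of E_{k+1,k+1}. With row k fixed it amounts to the sum of row
        k + 1, which settles the one degree of freedom that the k values leave open.\<close>
      let ?e = "\<lambda>S. of_nat (Suc k) - 1 + (\<Sum>i = 1..Suc k. S (Suc k, i)) - (\<Sum>i = 1..k. S (k, i)) :: complex"
      have keys_part_F: "Poly_Mapping.keys (part P ?v) \<subseteq> ?F" for P
        using keysB[OF v] by (auto simp: keys_part)
      have diag: "part (\<lambda>S. ?e S = ?e U) ?v \<in> W" (is "?v' \<in> W")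
      proof (rule eigen_component[OF sub _ v1])
        show "linear_extension (\<lambda>S. scale (?e S) (tab S)) w \<in> W" if "w \<in> W" for w
          using stable_diag[OF Suc.prems(2) _ that, of "Suc k"] by (simp add: gt_diag_def[abs_def])
        show "Poly_Mapping.keys ?v \<subseteq> ?F" using keys_part_F[of "\<lambda>_. True"] by (simp add: part_part)
      qed
      have vals: "part (\<lambda>S. \<forall>i\<in>I. row_value (Suc k) S (U (k, i)) = row_value (Suc k) U (U (k, i))) ?v' \<in> W"
        if "finite I" "I \<subseteq> {1..k}" for I
        using that
      proof induction
        case empty
        then show ?case using diag by (simp add: part_self)
      next
        case (insert i I)
        let ?u = "part (\<lambda>S. \<forall>i\<in>I. row_value (Suc k) S (U (k, i)) = row_value (Suc k) U (U (k, i))) ?v'"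
        have "part (\<lambda>S. row_value (Suc k) S (U (k, i)) = row_value (Suc k) U (U (k, i))) ?u \<in> W"
        proof (rule eigen_component[OF sub])
          show "linear_extension (\<lambda>S. scale (row_value (Suc k) S (U (k, i))) (tab S)) w \<in> W"
            if "w \<in> W" "Poly_Mapping.keys w \<subseteq> ?F" for w
            using that insert.prems by (intro separating_row_value[OF sep Suc.prems(2) k U]) auto
          show "?u \<in> W" using insert by simp
          show "Poly_Mapping.keys ?u \<subseteq> ?F" unfolding part_part[of _ "\<lambda>S. ?e S = ?e U"] by (rule keys_part_F)
        qed
        then show ?case by (simp add: part_part)
      qed
      have "part (\<lambda>S. \<forall>i\<in>{1..k}. row_value (Suc k) S (U (k, i)) = row_value (Suc k) U (U (k, i))) ?v'
          = part (agree (Suc k) U) v"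
        unfolding part_part
      proof (rule part_cong)
        fix T assume T: "T \<in> Poly_Mapping.keys v"
        have TB: "T \<in> B" using keysB[OF v T] .
        show "((\<forall>i\<in>{1..k}. row_value (Suc k) T (U (k, i)) = row_value (Suc k) U (U (k, i))) \<and>
            (?e T = ?e U \<and> agree k U T)) \<longleftrightarrow> agree (Suc k) U T" (is "?l \<longleftrightarrow> ?r")
        proof
          assume l: ?l
          then have "(\<Sum>i = 1..k. T (k, i)) = (\<Sum>i = 1..k. U (k, i))" by (simp add: agree_def)
          then have "(\<Sum>j=1..Suc k. U (Suc k, j)) = (\<Sum>j=1..Suc k. T (Suc k, j))"
            using l by simp
          then show ?r using l by (intro agree_SucI[OF U TB k]) auto
        next
          assume r: ?r
          then have "agree k U T" by (simp add: agree_def)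
          moreover have "T (k, i) = U (k, i)" "T (Suc k, i) = U (Suc k, i)" for i
            using r by (simp_all add: agree_def)
          ultimately show ?l by (simp add: row_value_def)
        qed
      qed
      then show ?thesis using vals[of "{1..k}"] by simp
    qed
  qed
  then show ?case using Suc.prems(2) by (simp add: separating_def)
qed

text \<open>For basis tableaux agreement in all n rows is equality, so the component is a nonzero
  multiple of one basis vector.\<close>

corollary stable_contains_tab:
  assumes "stable n W" "v \<in> W" "T \<in> Poly_Mapping.keys v"
  shows "tab T \<in> W"
proof -
  have T: "T \<in> B" by (rule stable_keys[OF assms])
  have "agree n T S \<longleftrightarrow> S = T" if "S \<in> Poly_Mapping.keys v" for S
  proof
    assume agree: "agree n T S"
    show "S = T"
    proof
      fix p
      show "S p = T p"
      proof (cases "fst p \<le> n")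
        case True
        then show ?thesis using agree unfolding agree_def by metis
      next
        case False
        then have "p \<notin> vertices n" by (auto simp: vertices_def)
        then show ?thesis using basis_outside[OF T stable_keys[OF assms(1,2) that]] by simp
      qed
    qed
  qed simp
  then have "part (agree n T) v = part (\<lambda>S. S = T) v" by (rule part_cong)
  also have "\<dots> = scale (Poly_Mapping.lookup v T) (tab T)"
    by (rule poly_mapping_eqI) (simp add: lookup_part lookup_tab)
  finally have "scale (Poly_Mapping.lookup v T) (tab T) \<in> W"
    using separation[OF order_refl assms(1)] assms(2) T unfolding separating_def by metis
  then have "scale (1 / Poly_Mapping.lookup v T) (scale (Poly_Mapping.lookup v T) (tab T)) \<in> W"
    using stable_subspace[OF assms(1)] linear_subspace_scale by blast
  then show ?thesis using assms(3) by (simp add: in_keys_iff)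
qed

text \<open>This is \<open>separating_shift\<close> for the single vector \<open>tab T\<close> and k
  = n; shifts between basis tableaux vanish on row n, as it requires.\<close>

corollary stable_upward_closed:
  assumes W: "stable n W" and T: "tab T \<in> W" and U: "U \<in> B" "descents n T \<subseteq> descents n U"
  shows "tab U \<in> W"
proof -
  have TB: "T \<in> B" using stable_keys[OF W T] by simp
  obtain z where z: "z \<in> int_shifts n" "U = shift z T" using basis_shift_between[OF TB U(1)] .
  have "linear_extension (\<lambda>S. tab (shift z S)) (tab T) \<in> W"
  proof (rule separating_shift[OF separation[OF order_refl W] order_refl TB z(1)])
    show "z p = 0" if "n \<le> fst p" for p
      using int_shifts_outside[OF z(1), of p] that by (cases p) (auto simp: vertices_def)
  qed (use z U T in auto)
  then show ?thesis by (simp add: z)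
qed

end

section \<open>Submodules generated by tableaux\<close>

lemma linear_gt_upper:
  "gt_upper B d i (u + v) = gt_upper B d i u + gt_upper B d i v"
  "gt_upper B d i (scale c v) = scale c (gt_upper B d i v)"
  by (induction d arbitrary: i u v c)
    (simp_all add: linear_extension_add linear_extension_scale commutator_def scale_diff)

lemma linear_gt_below:
  "gt_below B d i (u + v) = gt_below B d i u + gt_below B d i v"
  "gt_below B d i (scale c v) = scale c (gt_below B d i v)"
  by (induction d arbitrary: i u v c)
    (simp_all add: linear_extension_add linear_extension_scale commutator_def scale_diff)

lemma linear_gt_act:
  shows gt_act_add: "gt_act B i j (u + v) = gt_act B i j u + gt_act B i j v"
    and gt_act_scale: "gt_act B i j (scale c v) = scale c (gt_act B i j v)"
  by (simp_all add: gt_act_def linear_gt_upper linear_gt_below linear_extension_add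
      linear_extension_scale)

lemma gt_act_diff: "gt_act B i j (u - v) = gt_act B i j u - gt_act B i j v"
  using gt_act_add[of B i j "u - v" v] by simp

context relation_setting
begin

definition upward_closed :: "tableau set \<Rightarrow> bool" where
  "upward_closed N \<longleftrightarrow> N \<subseteq> B \<and> (\<forall>T\<in>N. \<forall>U\<in>B. descents n T \<subseteq> descents n U \<longrightarrow> U \<in> N)"

lemma upward_closed_raise:
  assumes N: "upward_closed N" and T: "T \<in> N" and k: "k < n"
  shows "gt_raise B k T \<in> tableau_span N"
proof -
  have TB: "T \<in> B" using N T by (auto simp: upward_closed_def)
  have "scale (raise_coeff k T i) (tab_in B (shift (delta (k, i)) T)) \<in> tableau_span N"
    if i: "i \<in> {1..k}" for i
  proof (cases "raise_coeff k T i = 0 \<or> shift (delta (k, i)) T \<notin> B")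
    case True
    then show ?thesis using linear_subspace_zero[OF linear_subspace_tableau_span] by auto
  next
    case False
    then have "shift (delta (k, i)) T \<in> N"
      using N T raise_coeff_nonzero[OF TB k i] by (auto simp: upward_closed_def)
    then show ?thesis
      using False by (intro linear_subspace_scale[OF linear_subspace_tableau_span]) simp
  qed
  then show ?thesis
    unfolding gt_raise_eq
    by (intro linear_subspace_uminus linear_subspace_sum linear_subspace_tableau_span)
qed

lemma upward_closed_lower:
  assumes N: "upward_closed N" and T: "T \<in> N" and k: "k < n"
  shows "gt_lower B k T \<in> tableau_span N"
proof -
  have TB: "T \<in> B" using N T by (auto simp: upward_closed_def)
  have "scale (lower_coeff k T i) (tab_in B (shift (\<lambda>p. - delta (k, i) p) T)) \<in> tableau_span N"
    if i: "i \<in> {1..k}" for i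
  proof (cases "lower_coeff k T i = 0 \<or> shift (\<lambda>p. - delta (k, i) p) T \<notin> B")
    case True
    then show ?thesis using linear_subspace_zero[OF linear_subspace_tableau_span] by auto
  next
    case False
    then have "shift (\<lambda>p. - delta (k, i) p) T \<in> N"
      using N T lower_coeff_nonzero[OF TB k i] by (auto simp: upward_closed_def)
    then show ?thesis
      using False by (intro linear_subspace_scale[OF linear_subspace_tableau_span]) simp
  qed
  then show ?thesis
    unfolding gt_lower_eq
    by (intro linear_subspace_sum linear_subspace_tableau_span)
qed

lemma upward_closed_act:
  assumes N: "upward_closed N" and ij: "i \<in> {1..n}" "j \<in> {1..n}" and v: "v \<in> tableau_span N"
  shows "gt_act B i j v \<in> tableau_span N"
proof -
  note diff = linear_subspace_diff[OF linear_subspace_tableau_span]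
  have raise: "linear_extension (gt_raise B k) v \<in> tableau_span N"
    if "k < n" "v \<in> tableau_span N" for k v
    by (rule linear_extension_in_tableau_span, rule upward_closed_raise[OF N _ that(1)])
      (use that(2) in \<open>auto simp: tableau_span_def\<close>)
  have lower: "linear_extension (gt_lower B k) v \<in> tableau_span N"
    if "k < n" "v \<in> tableau_span N" for k v
    by (rule linear_extension_in_tableau_span, rule upward_closed_lower[OF N _ that(1)])
      (use that(2) in \<open>auto simp: tableau_span_def\<close>)
  have diag: "linear_extension (gt_diag k) v \<in> tableau_span N" if "v \<in> tableau_span N" for k v
    unfolding gt_diag_def[abs_def]
    by (intro linear_extension_in_tableau_span linear_subspace_scale[OF linear_subspace_tableau_span])
      (use that in \<open>auto simp: tableau_span_def\<close>)
  \<comment> \<open>The bound says that the column index k + d + 1 is at most n, so every raising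
    operator in the nested commutator belongs to a row below the top.\<close>
  have upper: "gt_upper B d k v \<in> tableau_span N" if "k + d < n" "v \<in> tableau_span N" for d k v
    using that
  proof (induction d arbitrary: k v)
    case (Suc d)
    then show ?case
      unfolding gt_upper.simps commutator_def by (intro diff raise Suc.IH) simp_all
  qed (simp add: raise)
  have below: "gt_below B d k v \<in> tableau_span N" if "k + d < n" "v \<in> tableau_span N" for d k v
    using that
  proof (induction d arbitrary: k v)
    case (Suc d)
    then show ?case
      unfolding gt_below.simps commutator_def by (intro diff lower Suc.IH) simp_all
  qed (simp add: lower)
  show ?thesis
    unfolding gt_act_def using ij v by (auto intro: upper below diag)
qed

section \<open>Cyclic submodules and the sum of the smaller ones\<close>

abbreviation V :: "gt_vector gl_rep" where "V \<equiv> relation_module n G L"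

lemma relation_module_simps [simp]:
  "carrier V = tableau_span B" "zero V = 0" "add V = (+)" "module.smult V = scale"
  "act V = gt_act B"
  by (simp_all add: relation_module_def tableau_span_def)

definition above :: "tableau \<Rightarrow> tableau set" where
  "above T = {U \<in> B. descents n T \<subseteq> descents n U}"

lemma upward_closed_above: "upward_closed (above T)"
  unfolding upward_closed_def above_def by blast

lemma U_image_preserves:
  "X \<in> U_image n V \<Longrightarrow> upward_closed N \<Longrightarrow> v \<in> tableau_span N \<Longrightarrow> X v \<in> tableau_span N"
proof (induction arbitrary: v rule: U_image.induct)
  case (unit i j)
  then show ?case using upward_closed_act by simp
next
  case (add X Y)
  then show ?case using linear_subspace_add[OF linear_subspace_tableau_span] by simp
next
  case (smult X c)
  then show ?case using linear_subspace_scale[OF linear_subspace_tableau_span] by simp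
qed simp_all

lemma stableI:
  assumes W: "linear_subspace W" "W \<subseteq> tableau_span B"
    and act: "\<And>i j v. i \<in> {1..n} \<Longrightarrow> j \<in> {1..n} \<Longrightarrow> v \<in> W \<Longrightarrow> gt_act B i j v \<in> W"
  shows "stable n W"
  unfolding stable_def
proof (intro conjI ballI W)
  fix m v assume m: "m \<in> {1..<n}" and v: "v \<in> W"
  show "linear_extension (gt_raise B m) v \<in> W"
    using act[of m "Suc m" v] m v by (simp add: gt_act_def)
  show "linear_extension (gt_lower B m) v \<in> W"
    using act[of "Suc m" m v] m v by (simp add: gt_act_def)
next
  fix m v assume "m \<in> {1..n}" "v \<in> W"
  then show "linear_extension (gt_diag m) v \<in> W"
    using act[of m m v] by (simp add: gt_act_def)
qed

text \<open>The span of \<open>above T\<close> is invariant, which bounds the orbit from above; the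
  orbit is itself an invariant subspace containing \<open>tab T\<close>, so
  \<open>stable_upward_closed\<close> gives the rest.\<close>

theorem U_orbit_tab:
  assumes T: "T \<in> B"
  shows "U_orbit n V (tab T) = tableau_span (above T)"
proof
  let ?W = "U_orbit n V (tab T)"
  have T': "T \<in> above T" using T by (simp add: above_def)
  show sub: "?W \<subseteq> tableau_span (above T)"
    using U_image_preserves[OF _ upward_closed_above] T' by (auto simp: U_orbit_def)
  have "stable n ?W"
  proof (rule stableI)
    show "?W \<subseteq> tableau_span B"
      using sub by (auto simp: tableau_span_def above_def)
    have "scale c (X (tab T)) \<in> ?W" if "X \<in> U_image n V" for X c
      using U_image.smult[OF that, where c = c] by (auto simp: U_orbit_def)
    moreover have "X (tab T) + Y (tab T) \<in> ?W" if "X \<in> U_image n V" "Y \<in> U_image n V" for X Y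
      using U_image.add[OF that] by (auto simp: U_orbit_def)
    moreover have "0 \<in> ?W"
      using U_image.smult[where c = 0 and n = n and M = V, OF U_image.one] by (force simp: U_orbit_def)
    ultimately show "linear_subspace ?W"
      unfolding linear_subspace_def by (auto simp: U_orbit_def)
    show "gt_act B i j v \<in> ?W" if ij: "i \<in> {1..n}" "j \<in> {1..n}" and v: "v \<in> ?W" for i j v
    proof -
      obtain X where X: "X \<in> U_image n V" "v = X (tab T)" using v by (auto simp: U_orbit_def)
      have "(\<lambda>v. act V i j (X v)) \<in> U_image n V"
        by (rule U_image.mult[OF U_image.unit[OF ij] X(1)])
      then show ?thesis unfolding U_orbit_def X(2) by force
    qed
  qed
  moreover have "tab T \<in> ?W"
    unfolding U_orbit_def mem_Collect_eq
    by (rule exI[of _ "\<lambda>v. v"]) (simp add: U_image.one)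
  ultimately have "tab U \<in> ?W" if "U \<in> above T" for U
    using that stable_upward_closed by (auto simp: above_def)
  then show "tableau_span (above T) \<subseteq> ?W"
    using stable_subspace[OF \<open>stable n ?W\<close>] by (intro tableau_span_subset)
qed

lemma tableau_span_mono_iff: "tableau_span M \<subseteq> tableau_span N \<longleftrightarrow> M \<subseteq> N"
proof
  assume sub: "tableau_span M \<subseteq> tableau_span N"
  show "M \<subseteq> N"
  proof
    fix T assume "T \<in> M"
    then have "tab T \<in> tableau_span M" by simp
    then show "T \<in> N" using sub by (metis subsetD tab_in_tableau_span)
  qed
qed (auto simp: tableau_span_def)

end

lemma vectorspace_of_subspace:
  fixes M :: "(complex, gt_vector, 'm) module_scheme"
  assumes W: "linear_subspace (carrier M)"
    and M: "zero M = 0" "add M = (+)" "module.smult M = scale"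
  shows "vectorspace class_ring M"
proof -
  have "abelian_group M"
  proof (rule abelian_groupI)
    show "\<exists>y\<in>carrier M. y \<oplus>\<^bsub>M\<^esub> x = \<zero>\<^bsub>M\<^esub>" if "x \<in> carrier M" for x
      using linear_subspace_uminus[OF W that] by (intro bexI[of _ "- x"]) (simp_all add: M)
  qed (use W in \<open>simp_all add: M linear_subspace_add linear_subspace_zero add_ac\<close>)
  then have "Module.module class_ring M"
    by (intro moduleI class_cring.is_cring)
      (use W in \<open>simp_all add: M linear_subspace_scale scale_add scale_add_left class_cring.cring_axioms\<close>)
  then show ?thesis by (intro vectorspace.intro class_field)
qed

lemma finsum_gt_vectors:
  fixes M :: "(complex, gt_vector, 'm) module_scheme"
  assumes W: "linear_subspace (carrier M)"
    and M: "zero M = 0" "add M = (+)" "module.smult M = scale"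
    and F: "finite F" "\<And>q. q \<in> F \<Longrightarrow> w q \<in> carrier M"
  shows "finsum M w F = (\<Sum>q\<in>F. w q)"
proof -
  interpret vectorspace class_ring M by (rule vectorspace_of_subspace[OF W M])
  show ?thesis using F by (induction F) (simp_all add: M)
qed

context relation_setting
begin

definition strictly_above :: "tableau \<Rightarrow> tableau set" where
  "strictly_above T = {U \<in> B. descents n T \<subset> descents n U}"

lemma upward_closed_strictly_above: "upward_closed (strictly_above T)"
  unfolding upward_closed_def strictly_above_def by blast

text \<open>Orbits are compared through their index sets, so a properly smaller one belongs to a
  tableau with strictly more arrows. These tableaux are upward closed, hence the sum of their orbits
  stays in their span.\<close>

lemma smaller_submodules_eq:
  assumes R: "R \<in> B"
  shows "smaller_submodules n G L R = tableau_span (strictly_above R)"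
proof -
  let ?I = "{Q \<in> B. tab Q \<in> U_orbit n V (tab R) \<and> U_orbit n V (tab Q) \<subset> U_orbit n V (tab R)}"
  have index: "?I = strictly_above R"
  proof (intro equalityI subsetI)
    fix Q assume "Q \<in> ?I"
    then have Q: "Q \<in> B" "Q \<in> above R" "tableau_span (above Q) \<subset> tableau_span (above R)"
      using U_orbit_tab R by auto
    then have "\<not> above R \<subseteq> above Q" using tableau_span_mono_iff by (metis psubset_eq subset_antisym)
    then show "Q \<in> strictly_above R" using Q by (auto simp: above_def strictly_above_def)
  next
    fix Q assume Q: "Q \<in> strictly_above R"
    then have "above Q \<subset> above R" using R by (auto simp: above_def strictly_above_def)
    then have "tableau_span (above Q) \<subset> tableau_span (above R)"
      using tableau_span_mono_iff by (metis psubset_eq subset_antisym)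
    then show "Q \<in> ?I" using Q R U_orbit_tab by (auto simp: above_def strictly_above_def)
  qed
  have V: "linear_subspace (carrier V)" by (simp add: linear_subspace_tableau_span)
  have orbit: "U_orbit n V (tab Q) \<subseteq> tableau_span (strictly_above R)" if "Q \<in> strictly_above R" for Q
    using that U_orbit_tab[of Q]
    by (auto simp: tableau_span_mono_iff above_def strictly_above_def)
  have finsum: "finsum V w F = (\<Sum>q\<in>F. w q)"
    if "finite F" "F \<subseteq> strictly_above R" "\<forall>q\<in>F. w q \<in> U_orbit n V (tab q)" for F w
  proof (rule finsum_gt_vectors[OF V _ _ _ that(1)])
    show "w q \<in> carrier V" if "q \<in> F" for q
      using that \<open>F \<subseteq> strictly_above R\<close> \<open>\<forall>q\<in>F. w q \<in> U_orbit n V (tab q)\<close> orbit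
      by (fastforce simp: tableau_span_def strictly_above_def)
  qed simp_all
  show ?thesis
    unfolding smaller_submodules_def Let_def sum_of_submodules_def index
  proof (intro equalityI subsetI)
    fix v assume "v \<in> {finsum V w F |w F. finite F \<and> F \<subseteq> strictly_above R \<and>
      (\<forall>q\<in>F. w q \<in> U_orbit n V (tab q))}"
    then obtain w F where F: "finite F" "F \<subseteq> strictly_above R" "\<forall>q\<in>F. w q \<in> U_orbit n V (tab q)"
      and "v = finsum V w F" by blast
    then have "v = (\<Sum>q\<in>F. w q)" using finsum by simp
    also have "\<dots> \<in> tableau_span (strictly_above R)"
      using F orbit by (intro linear_subspace_sum[OF linear_subspace_tableau_span]) blast
    finally show "v \<in> tableau_span (strictly_above R)" .
  next
    fix v assume v: "v \<in> tableau_span (strictly_above R)"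
    \<comment> \<open>The expansion of \<open>v\<close> in basis vectors is already such a sum, each
      tableau lying in its own orbit.\<close>
    let ?w = "\<lambda>q. scale (Poly_Mapping.lookup v q) (tab q)"
    let ?F = "Poly_Mapping.keys v"
    have F: "?F \<subseteq> strictly_above R" using v by (simp add: tableau_span_def)
    have w: "\<forall>q\<in>?F. ?w q \<in> U_orbit n V (tab q)"
    proof
      fix q assume "q \<in> ?F"
      then have q: "q \<in> B" using F by (auto simp: strictly_above_def)
      then have "tab q \<in> tableau_span (above q)" by (simp add: above_def)
      then show "?w q \<in> U_orbit n V (tab q)"
        unfolding U_orbit_tab[OF q] by (rule linear_subspace_scale[OF linear_subspace_tableau_span])
    qed
    have "v = linear_extension tab v" by simp
    also have "\<dots> = finsum V ?w ?F"
      unfolding linear_extension_def using finsum[OF finite_keys F w] by simp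
    finally show "v \<in> {finsum V w F |w F. finite F \<and> F \<subseteq> strictly_above R \<and>
      (\<forall>q\<in>F. w q \<in> U_orbit n V (tab q))}" using F w finite_keys by blast
  qed
qed

end

section \<open>The subquotient\<close>

definition coset :: "gt_vector set \<Rightarrow> gt_vector \<Rightarrow> gt_vector set" where
  "coset K u = {w. w - u \<in> K}"

lemma r_coset_eq_coset:
  assumes "add M = (+)"
  shows "K +>\<^bsub>M\<^esub> u = coset K u"
proof -
  have "K +>\<^bsub>M\<^esub> u = (\<lambda>k. k + u) ` K" by (auto simp: a_r_coset_def' assms)
  also have "\<dots> = coset K u"
    by (auto simp: coset_def intro!: image_eqI[where x = "_ - u"])
  finally show ?thesis .
qed

lemma coset_eq_iff:
  assumes K: "linear_subspace K"
  shows "coset K u = coset K v \<longleftrightarrow> u - v \<in> K"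
proof
  assume "coset K u = coset K v"
  moreover have "u \<in> coset K u" using linear_subspace_zero[OF K] by (simp add: coset_def)
  ultimately show "u - v \<in> K" by (simp add: coset_def)
next
  assume uv: "u - v \<in> K"
  have "w - v \<in> K" if "w - u \<in> K" for w
    using linear_subspace_add[OF K that uv] by simp
  moreover have "w - u \<in> K" if "w - v \<in> K" for w
    using linear_subspace_diff[OF K that uv] by simp
  ultimately show "coset K u = coset K v" by (auto simp: coset_def)
qed

lemma coset_zero: "coset K 0 = K"
  by (simp add: coset_def)

text \<open>The quotient operations are unions over all representatives; for an additive
  \<open>f\<close> preserving \<open>K\<close> these all give the same coset.\<close>

lemma coset_UN:
  assumes K: "linear_subspace K" and f: "\<And>x y. f (x - y) = f x - f y" "\<And>k. k \<in> K \<Longrightarrow> f k \<in> K"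
  shows "(\<Union>v\<in>coset K u. coset K (f v)) = coset K (f u)"
proof -
  have "coset K (f v) = coset K (f u)" if "v \<in> coset K u" for v
  proof -
    have "f (v - u) \<in> K" using that f(2) by (simp add: coset_def)
    then show ?thesis unfolding coset_eq_iff[OF K] f(1) .
  qed
  moreover have "u \<in> coset K u" using linear_subspace_zero[OF K] by (simp add: coset_def)
  ultimately show ?thesis by blast
qed

lemma coset_add:
  assumes K: "linear_subspace K" and "add M = (+)"
  shows "coset K u <+>\<^bsub>M\<^esub> coset K v = coset K (u + v)"
proof (intro equalityI subsetI)
  fix w assume "w \<in> coset K u <+>\<^bsub>M\<^esub> coset K v"
  then obtain x y where xy: "x - u \<in> K" "y - v \<in> K" "w = x + y"
    by (auto simp: set_add_def' assms(2) coset_def)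
  have eq: "w - (u + v) = (x - u) + (y - v)" by (simp add: xy(3))
  show "w \<in> coset K (u + v)"
    unfolding coset_def mem_Collect_eq eq by (rule linear_subspace_add[OF K xy(1,2)])
next
  fix w assume w: "w \<in> coset K (u + v)"
  have "w - v \<in> coset K u" using w by (simp add: coset_def algebra_simps)
  moreover have "v \<in> coset K v" using linear_subspace_zero[OF K] by (simp add: coset_def)
  moreover have "w = (w - v) + v" by simp
  ultimately show "w \<in> coset K u <+>\<^bsub>M\<^esub> coset K v"
    unfolding set_add_def' assms(2) by blast
qed

section \<open>The subquotient as a module: simplicity and basis\<close>

locale orbit_setting = relation_setting +
  fixes R :: tableau
  assumes R: "R \<in> B"
begin

abbreviation K :: "gt_vector set" where "K \<equiv> tableau_span (strictly_above R)"
abbreviation W :: "gt_vector set" where "W \<equiv> tableau_span (above R)"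
abbreviation Q :: "gt_vector set gl_rep" where "Q \<equiv> subquotient n G L R"

lemma linear_K: "linear_subspace K" and linear_W: "linear_subspace W"
  by (rule linear_subspace_tableau_span)+

lemma W_subset_carrier: "W \<subseteq> tableau_span B"
  unfolding tableau_span_mono_iff by (auto simp: above_def)

lemma act_K: "i \<in> {1..n} \<Longrightarrow> j \<in> {1..n} \<Longrightarrow> v \<in> K \<Longrightarrow> gt_act B i j v \<in> K"
  by (rule upward_closed_act[OF upward_closed_strictly_above])

lemma act_W: "i \<in> {1..n} \<Longrightarrow> j \<in> {1..n} \<Longrightarrow> v \<in> W \<Longrightarrow> gt_act B i j v \<in> W"
  by (rule upward_closed_act[OF upward_closed_above])

lemma subquotient_eq: "Q = quotient_rep (V\<lparr>carrier := W\<rparr>) K"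
  by (simp add: subquotient_def U_orbit_tab[OF R] smaller_submodules_eq[OF R])

lemma subquotient_carrier: "carrier Q = coset K ` W"
  unfolding subquotient_eq quotient_rep_def
  by (auto simp: A_RCOSETS_def' r_coset_eq_coset)

lemma subquotient_zero: "\<zero>\<^bsub>Q\<^esub> = coset K 0"
  by (simp add: subquotient_eq quotient_rep_def coset_zero)

lemma subquotient_add: "coset K u \<oplus>\<^bsub>Q\<^esub> coset K v = coset K (u + v)"
  unfolding subquotient_eq quotient_rep_def by (simp add: coset_add[OF linear_K])

lemma subquotient_smult: "c \<odot>\<^bsub>Q\<^esub> coset K u = coset K (scale c u)"
  unfolding subquotient_eq quotient_rep_def
  using coset_UN[OF linear_K, of "scale c" u] linear_subspace_scale[OF linear_K]
  by (simp add: r_coset_eq_coset scale_diff)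

lemma subquotient_act:
  "i \<in> {1..n} \<Longrightarrow> j \<in> {1..n} \<Longrightarrow> act Q i j (coset K u) = coset K (gt_act B i j u)"
  unfolding subquotient_eq quotient_rep_def
  using coset_UN[OF linear_K, of "gt_act B i j" u] act_K[of i j]
  by (simp add: r_coset_eq_coset gt_act_diff)

lemma subquotient_carrierE:
  assumes "x \<in> carrier Q"
  obtains u where "u \<in> W" "x = coset K u"
  using assms unfolding subquotient_carrier by blast

lemma coset_in_carrier: "u \<in> W \<Longrightarrow> coset K u \<in> carrier Q"
  unfolding subquotient_carrier by blast

lemma subquotient_abelian_group: "abelian_group Q"
proof (rule abelian_groupI)
  fix x y z assume "x \<in> carrier Q" "y \<in> carrier Q"
  then obtain u v where uv: "u \<in> W" "x = coset K u" "v \<in> W" "y = coset K v"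
    by (meson subquotient_carrierE)
  then show "x \<oplus>\<^bsub>Q\<^esub> y \<in> carrier Q"
    by (simp add: subquotient_add coset_in_carrier linear_subspace_add[OF linear_W])
  show "x \<oplus>\<^bsub>Q\<^esub> y = y \<oplus>\<^bsub>Q\<^esub> x" by (simp add: uv subquotient_add add.commute)
  assume "z \<in> carrier Q"
  then obtain w where "z = coset K w" by (rule subquotient_carrierE)
  then show "x \<oplus>\<^bsub>Q\<^esub> y \<oplus>\<^bsub>Q\<^esub> z = x \<oplus>\<^bsub>Q\<^esub> (y \<oplus>\<^bsub>Q\<^esub> z)"
    by (simp add: uv subquotient_add add.assoc)
next
  show "\<zero>\<^bsub>Q\<^esub> \<in> carrier Q"
    unfolding subquotient_zero by (rule coset_in_carrier[OF linear_subspace_zero[OF linear_W]])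
  fix x assume "x \<in> carrier Q"
  then obtain u where u: "u \<in> W" "x = coset K u" by (rule subquotient_carrierE)
  show "\<zero>\<^bsub>Q\<^esub> \<oplus>\<^bsub>Q\<^esub> x = x" by (simp add: u subquotient_zero subquotient_add)
  show "\<exists>y\<in>carrier Q. y \<oplus>\<^bsub>Q\<^esub> x = \<zero>\<^bsub>Q\<^esub>"
    using coset_in_carrier[OF linear_subspace_uminus[OF linear_W u(1)]]
    by (intro bexI[of _ "coset K (- u)"]) (simp_all add: u subquotient_zero subquotient_add)
qed

lemma subquotient_vectorspace: "vectorspace class_ring Q"
proof -
  have "Module.module class_ring Q"
  proof (rule moduleI)
    show "cring (class_ring :: complex ring)" by (rule class_cring.cring_axioms)
    show "abelian_group Q" by (rule subquotient_abelian_group)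
    fix a b :: complex and x y assume "x \<in> carrier Q"
    then obtain u where u: "u \<in> W" "x = coset K u" by (rule subquotient_carrierE)
    show "a \<odot>\<^bsub>Q\<^esub> x \<in> carrier Q"
      by (simp add: u subquotient_smult coset_in_carrier linear_subspace_scale[OF linear_W])
    show "(a \<oplus>\<^bsub>class_ring\<^esub> b) \<odot>\<^bsub>Q\<^esub> x = a \<odot>\<^bsub>Q\<^esub> x \<oplus>\<^bsub>Q\<^esub> b \<odot>\<^bsub>Q\<^esub> x"
      by (simp add: u subquotient_smult subquotient_add scale_add_left)
    show "(a \<otimes>\<^bsub>class_ring\<^esub> b) \<odot>\<^bsub>Q\<^esub> x = a \<odot>\<^bsub>Q\<^esub> (b \<odot>\<^bsub>Q\<^esub> x)"
      by (simp add: u subquotient_smult)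
    show "\<one>\<^bsub>class_ring\<^esub> \<odot>\<^bsub>Q\<^esub> x = x" by (simp add: u subquotient_smult)
    assume "y \<in> carrier Q"
    then obtain v where "y = coset K v" by (rule subquotient_carrierE)
    then show "a \<odot>\<^bsub>Q\<^esub> (x \<oplus>\<^bsub>Q\<^esub> y) = a \<odot>\<^bsub>Q\<^esub> x \<oplus>\<^bsub>Q\<^esub> a \<odot>\<^bsub>Q\<^esub> y"
      by (simp add: u subquotient_smult subquotient_add scale_add)
  qed
  then show ?thesis by (intro vectorspace.intro class_field)
qed

lemma subquotient_gl_action: "gl_action n Q"
  unfolding gl_action_def
proof (intro conjI ballI subquotient_vectorspace)
  fix i j assume ij: "i \<in> {1..n}" "j \<in> {1..n}"
  note module = vectorspace.axioms(1)[OF subquotient_vectorspace]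
  have "act Q i j \<in> LinearCombinations.module_hom class_ring Q Q"
    unfolding LinearCombinations.module_hom_def
  proof (intro CollectI conjI allI impI Pi_I)
    show "act Q i j x \<in> carrier Q" if x: "x \<in> carrier Q" for x
    proof -
      obtain u where "u \<in> W" "x = coset K u" using x by (rule subquotient_carrierE)
      then show ?thesis using ij by (simp add: subquotient_act coset_in_carrier act_W)
    qed
    show "act Q i j (x \<oplus>\<^bsub>Q\<^esub> y) = act Q i j x \<oplus>\<^bsub>Q\<^esub> act Q i j y"
      if xy: "x \<in> carrier Q \<and> y \<in> carrier Q" for x y
    proof -
      obtain u v where "x = coset K u" "y = coset K v" using xy by (meson subquotient_carrierE)
      then show ?thesis using ij by (simp add: subquotient_act subquotient_add gt_act_add)
    qed
    show "act Q i j (c \<odot>\<^bsub>Q\<^esub> x) = c \<odot>\<^bsub>Q\<^esub> act Q i j x"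
      if cx: "c \<in> carrier class_ring \<and> x \<in> carrier Q" for c x
    proof -
      obtain u where "x = coset K u" using cx by (meson subquotient_carrierE)
      then show ?thesis using ij by (simp add: subquotient_act subquotient_smult gt_act_scale)
    qed
  qed
  then show "linear_map class_ring Q Q (act Q i j)"
    by (intro linear_map.intro subquotient_vectorspace mod_hom.intro module mod_hom_axioms.intro)
qed

text \<open>Together with \<open>above_cases\<close>: an inclusion of arrow sets is strict or an
  equality, so \<open>above R\<close> splits into \<open>strictly_above R\<close> and
  \<open>basis_index n G L R\<close>.\<close>

lemma basis_index_subset: "S \<in> basis_index n G L R \<Longrightarrow> S \<in> above R - strictly_above R"
  by (auto simp: basis_index_def above_def strictly_above_def descents_def)

lemma above_cases: "S \<in> above R \<Longrightarrow> S \<in> strictly_above R \<or> S \<in> basis_index n G L R"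
  by (auto simp: basis_index_def above_def strictly_above_def descents_def)

lemma tab_class_eq: "tab_class n G L R S = coset K (tab S)"
  unfolding tab_class_def smaller_submodules_eq[OF R] by (rule r_coset_eq_coset) simp

text \<open>Pull a submodule back to the orbit. A representative of a nonzero class has in its
  support a tableau outside \<open>strictly_above R\<close>; this has the same arrows as
  \<open>R\<close>, so it lies in the preimage and generates everything above
  \<open>R\<close>.\<close>

lemma subquotient_simple: "simple_gl n Q"
  unfolding simple_gl_def
proof (intro conjI allI impI subquotient_gl_action)
  have "R \<in> above R" "R \<notin> strictly_above R" using R by (auto simp: above_def strictly_above_def)
  then have "coset K (tab R) \<in> carrier Q" "coset K (tab R) \<noteq> \<zero>\<^bsub>Q\<^esub>"
    by (simp_all add: coset_in_carrier subquotient_zero coset_eq_iff[OF linear_K])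
  then show "carrier Q \<noteq> {\<zero>\<^bsub>Q\<^esub>}" by blast
next
  fix P assume P: "gl_submodule n P Q"
  then have "submodule class_ring P Q"
    unfolding gl_submodule_def VectorSpace.subspace_def by blast
  then interpret P: submodule class_ring P Q .
  have actP: "act Q i j x \<in> P" if "i \<in> {1..n}" "j \<in> {1..n}" "x \<in> P" for i j x
    using P that unfolding gl_submodule_def by blast
  let ?U = "{u \<in> W. coset K u \<in> P}"
  have "linear_subspace ?U"
    unfolding linear_subspace_def
  proof (intro conjI ballI allI)
    show "0 \<in> ?U" using P.zero_closed linear_subspace_zero[OF linear_W] by (simp add: subquotient_zero)
    show "u + v \<in> ?U" if "u \<in> ?U" "v \<in> ?U" for u v
      using that P.m_closed[of "coset K u" "coset K v"] linear_subspace_add[OF linear_W]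
      by (simp add: subquotient_add)
    show "scale c u \<in> ?U" if "u \<in> ?U" for c u
      using that P.smult_closed[of c "coset K u"] linear_subspace_scale[OF linear_W]
      by (simp add: subquotient_smult)
  qed
  then have stable: "stable n ?U"
  proof (rule stableI)
    show "?U \<subseteq> tableau_span B" using W_subset_carrier by blast
    show "gt_act B i j u \<in> ?U" if "i \<in> {1..n}" "j \<in> {1..n}" "u \<in> ?U" for i j u
      using that actP[of i j "coset K u"] act_W by (simp add: subquotient_act)
  qed
  show "P = {\<zero>\<^bsub>Q\<^esub>} \<or> P = carrier Q"
  proof (rule disjCI)
    assume "P \<noteq> carrier Q"
    show "P = {\<zero>\<^bsub>Q\<^esub>}"
    proof (rule ccontr)
      assume "P \<noteq> {\<zero>\<^bsub>Q\<^esub>}"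
      then obtain x where x: "x \<in> P" "x \<noteq> \<zero>\<^bsub>Q\<^esub>" using P.zero_closed by blast
      then have "x \<in> carrier Q" using P.subset by blast
      then obtain u where u: "u \<in> W" "x = coset K u" by (rule subquotient_carrierE)
      then have "u \<notin> K" using x by (simp add: subquotient_zero coset_eq_iff[OF linear_K])
      then obtain T where T: "T \<in> Poly_Mapping.keys u" "T \<notin> strictly_above R"
        by (auto simp: tableau_span_def)
      then have "T \<in> basis_index n G L R" using u above_cases by (auto simp: tableau_span_def)
      then have D: "descents n T = descents n R" by (simp add: basis_index_def descents_def)
      have "tab T \<in> ?U" using stable_contains_tab[OF stable _ T(1)] u x by blast
      have "tab S \<in> ?U" if S: "S \<in> above R" for S
      proof -
        have "S \<in> B" "descents n T \<subseteq> descents n S" using S D by (auto simp: above_def)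
        then show ?thesis by (rule stable_upward_closed[OF stable \<open>tab T \<in> ?U\<close>])
      qed
      then have "W \<subseteq> ?U" using \<open>linear_subspace ?U\<close> by (intro tableau_span_subset)
      then have "carrier Q \<subseteq> P" unfolding subquotient_carrier by blast
      then show False using P.subset \<open>P \<noteq> carrier Q\<close> by blast
    qed
  qed
qed

text \<open>Each bracket relation is evaluated on a representative of the coset. The remaining work
  identifies the abstract subtraction of both records with subtraction of vectors.\<close>

lemma subquotient_gl_module:
  assumes V: "gl_module n V"
  shows "gl_module n Q"
  unfolding gl_module_def
proof (intro conjI ballI subquotient_gl_action)
  fix i j k l x
  assume ijkl: "i \<in> {1..n}" "j \<in> {1..n}" "k \<in> {1..n}" "l \<in> {1..n}" and "x \<in> carrier Q"
  then obtain u where u: "u \<in> W" "x = coset K u" by (meson subquotient_carrierE)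
  interpret V: vectorspace class_ring V
    using V unfolding gl_module_def gl_action_def by blast
  interpret Q: abelian_group Q by (rule subquotient_abelian_group)
  have minus_V: "v \<ominus>\<^bsub>V\<^esub> w = v - w" if "v \<in> W" "w \<in> W" for v w
  proof -
    have "\<ominus>\<^bsub>V\<^esub> w = - w"
      using that W_subset_carrier linear_subspace_uminus[OF linear_W]
      by (intro V.minus_equality) auto
    then show ?thesis by (simp add: a_minus_def)
  qed
  have minus_Q: "coset K v \<ominus>\<^bsub>Q\<^esub> coset K w = coset K (v - w)" if "v \<in> W" "w \<in> W" for v w
  proof -
    have "\<ominus>\<^bsub>Q\<^esub> coset K w = coset K (- w)"
      using that linear_subspace_uminus[OF linear_W]
      by (intro Q.minus_equality) (auto simp: subquotient_add subquotient_zero coset_in_carrier)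
    then show ?thesis by (simp add: a_minus_def subquotient_add)
  qed
  have zero: "0 \<in> W" by (rule linear_subspace_zero[OF linear_W])
  have bracket: "gt_act B i j (gt_act B k l u) - gt_act B k l (gt_act B i j u) =
      (if j = k then gt_act B i l u else 0) - (if l = i then gt_act B k j u else 0)"
  proof -
    have "u \<in> carrier V" using u W_subset_carrier by auto
    then have "act V i j (act V k l u) \<ominus>\<^bsub>V\<^esub> act V k l (act V i j u) =
        (if j = k then act V i l u else \<zero>\<^bsub>V\<^esub>) \<ominus>\<^bsub>V\<^esub> (if l = i then act V k j u else \<zero>\<^bsub>V\<^esub>)"
      using V ijkl unfolding gl_module_def by blast
    then show ?thesis using ijkl u zero by (simp add: minus_V act_W split: if_splits)
  qed
  have "(if j = k then act Q i l x else \<zero>\<^bsub>Q\<^esub>) = coset K (if j = k then gt_act B i l u else 0)"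
    "(if l = i then act Q k j x else \<zero>\<^bsub>Q\<^esub>) = coset K (if l = i then gt_act B k j u else 0)"
    using ijkl by (simp_all add: u subquotient_act subquotient_zero)
  moreover have "(if j = k then gt_act B i l u else 0) \<in> W" "(if l = i then gt_act B k j u else 0) \<in> W"
    using ijkl u zero by (simp_all add: act_W)
  ultimately show "act Q i j (act Q k l x) \<ominus>\<^bsub>Q\<^esub> act Q k l (act Q i j x) =
      (if j = k then act Q i l x else \<zero>\<^bsub>Q\<^esub>) \<ominus>\<^bsub>Q\<^esub> (if l = i then act Q k j x else \<zero>\<^bsub>Q\<^esub>)"
    using ijkl u by (simp add: minus_Q subquotient_act act_W bracket)
qed

text \<open>The difference of two such basis vectors is supported on tableaux with exactly the
  arrows of \<open>R\<close>, while vectors in \<open>K\<close> are supported on tableaux with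
  more.\<close>

lemma tab_class_inj: "inj_on (tab_class n G L R) (basis_index n G L R)"
proof (rule inj_onI, rule ccontr)
  fix S T assume ST: "S \<in> basis_index n G L R" "T \<in> basis_index n G L R"
    "tab_class n G L R S = tab_class n G L R T" "S \<noteq> T"
  then have "tab S - tab T \<in> K" by (simp add: tab_class_eq coset_eq_iff[OF linear_K])
  moreover have "S \<in> Poly_Mapping.keys (tab S - tab T)"
    using ST(4) by (simp add: in_keys_iff lookup_minus lookup_tab)
  ultimately show False using basis_index_subset[OF ST(1)] by (auto simp: tableau_span_def)
qed

lemma tab_class_basis: "vectorspace.basis class_ring Q (tab_class n G L R ` basis_index n G L R)"
proof -
  let ?I = "basis_index n G L R" and ?c = "tab_class n G L R"
  interpret Q: vectorspace class_ring Q by (rule subquotient_vectorspace)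
  have in_W: "tab S \<in> W" if "S \<in> ?I" for S using basis_index_subset[OF that] by simp
  have carrier: "?c ` ?I \<subseteq> carrier Q"
    using in_W coset_in_carrier by (auto simp: tab_class_eq)
  have lincomb: "Q.lincomb a (?c ` F) = coset K (\<Sum>S\<in>F. scale (a (?c S)) (tab S))"
    if "finite F" "F \<subseteq> ?I" for a F
    using that
  proof induction
    case empty
    then show ?case by (simp add: Q.lincomb_def subquotient_zero)
  next
    case (insert S F)
    \<comment> \<open>Injectivity lets the sum over the image be split like a sum over
      tableaux.\<close>
    have "?c S \<notin> ?c ` F"
      using insert.hyps insert.prems inj_onD[OF tab_class_inj] by blast
    moreover have "(\<lambda>v. a v \<odot>\<^bsub>Q\<^esub> v) \<in> ?c ` insert S F \<rightarrow> carrier Q"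
      using carrier insert.prems by (intro Pi_I Q.smult_closed) auto
    ultimately have "Q.lincomb a (?c ` insert S F) = a (?c S) \<odot>\<^bsub>Q\<^esub> ?c S \<oplus>\<^bsub>Q\<^esub> Q.lincomb a (?c ` F)"
      unfolding Q.lincomb_def using insert.hyps(1) by (simp add: Pi_def)
    then show ?case
      using insert by (simp add: tab_class_eq subquotient_smult subquotient_add)
  qed
  have "\<not> Q.lin_dep (?c ` ?I)"
  proof
    assume "Q.lin_dep (?c ` ?I)"
    then obtain A a v where A: "finite A" "A \<subseteq> ?c ` ?I" "Q.lincomb a A = \<zero>\<^bsub>Q\<^esub>" "v \<in> A" "a v \<noteq> 0"
      unfolding Q.lin_dep_def by auto
    obtain F where F: "F \<subseteq> ?I" "finite F" "A = ?c ` F"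
      using finite_subset_image[OF A(1,2)] by blast
    obtain S where S: "S \<in> F" "v = ?c S" using A(4) F(3) by blast
    let ?s = "\<Sum>S\<in>F. scale (a (?c S)) (tab S)"
    have "?s \<in> K"
      using A(3) lincomb[OF F(2,1)] by (simp add: F(3) subquotient_zero coset_eq_iff[OF linear_K])
    moreover have "Poly_Mapping.lookup ?s S = a v"
      using S F(2) by (simp add: lookup_sum lookup_tab if_distrib[of "\<lambda>x. _ * x"] cong: if_cong)
    ultimately have "S \<in> strictly_above R"
      using A(5) by (auto simp: tableau_span_def in_keys_iff)
    then show False using basis_index_subset[of S] S F by auto
  qed
  moreover have "Q.span (?c ` ?I) = carrier Q"
  proof
    show "Q.span (?c ` ?I) \<subseteq> carrier Q" using carrier by (rule Q.span_is_subset2)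
    show "carrier Q \<subseteq> Q.span (?c ` ?I)"
    proof
      fix x assume "x \<in> carrier Q"
      then obtain u where u: "u \<in> W" "x = coset K u" by (rule subquotient_carrierE)
      let ?F = "{S \<in> Poly_Mapping.keys u. S \<in> ?I}"
      \<comment> \<open>Coefficients have to be indexed by classes; the inverse of
        \<open>tab_class\<close> reads off the tableau.\<close>
      let ?a = "\<lambda>A. Poly_Mapping.lookup u (the_inv_into ?I ?c A)"
      have F: "finite ?F" "?F \<subseteq> ?I" by auto
      have "Q.lincomb ?a (?c ` ?F) = coset K (\<Sum>S\<in>?F. scale (?a (?c S)) (tab S))"
        using F by (rule lincomb)
      also have "(\<Sum>S\<in>?F. scale (?a (?c S)) (tab S)) = (\<Sum>S\<in>?F. scale (Poly_Mapping.lookup u S) (tab S))"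
        by (rule sum.cong) (simp_all add: the_inv_into_f_f[OF tab_class_inj])
      also have "coset K \<dots> = coset K u"
      proof -
        \<comment> \<open>The remaining tableaux of \<open>u\<close> have strictly more arrows than
          \<open>R\<close>, so they vanish modulo \<open>K\<close>.\<close>
        let ?F' = "{S \<in> Poly_Mapping.keys u. S \<notin> ?I}"
        have "u = (\<Sum>S\<in>Poly_Mapping.keys u. scale (Poly_Mapping.lookup u S) (tab S))"
          using linear_extension_id[of u] by (simp add: linear_extension_def)
        also have "\<dots> = (\<Sum>S\<in>?F. scale (Poly_Mapping.lookup u S) (tab S)) +
            (\<Sum>S\<in>?F'. scale (Poly_Mapping.lookup u S) (tab S))"
          by (subst sum.union_disjoint[symmetric]) (auto intro!: sum.cong)
        finally have diff: "u - (\<Sum>S\<in>?F. scale (Poly_Mapping.lookup u S) (tab S)) =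
            (\<Sum>S\<in>?F'. scale (Poly_Mapping.lookup u S) (tab S))"
          by (simp add: algebra_simps)
        have "(\<Sum>S\<in>?F'. scale (Poly_Mapping.lookup u S) (tab S)) \<in> K"
        proof (rule linear_subspace_sum[OF linear_K])
          fix S assume "S \<in> ?F'"
          then have "S \<in> strictly_above R" using u above_cases by (auto simp: tableau_span_def)
          then show "scale (Poly_Mapping.lookup u S) (tab S) \<in> K"
            by (intro linear_subspace_scale[OF linear_K]) simp
        qed
        then have "coset K u = coset K (\<Sum>S\<in>?F. scale (Poly_Mapping.lookup u S) (tab S))"
          unfolding coset_eq_iff[OF linear_K] diff .
        then show ?thesis by (rule sym)
      qed
      finally show "x \<in> Q.span (?c ` ?I)"
        unfolding Q.span_def u(2)
        by (intro CollectI exI[of _ ?a] exI[of _ "?c ` ?F"]) auto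
    qed
  qed
  ultimately show ?thesis unfolding Q.basis_def using carrier by blast
qed

end

text \<open>The bracket relations on the ambient module are the known theorem quoted with its
  definition, so they enter as a premise. Injectivity is stated separately because a basis given as
  an image set does not show that distinct tableaux have distinct classes.\<close>

theorem theorem4p14:
  fixes n :: nat and G :: graph and L R :: tableau
  assumes "2 \<le> n"
    and "relation_graph n G"
    and "realization n G L"
    and "R \<in> basis_tableaux n G L"
  shows "simple_gl n (subquotient n G L R) \<and>
    (gl_module n (relation_module n G L) \<longrightarrow> gl_module n (subquotient n G L R)) \<and>
    inj_on (tab_class n G L R) (basis_index n G L R) \<and>
    vectorspace.basis class_ring (subquotient n G L R)
      (tab_class n G L R ` basis_index n G L R)"
proof -
  interpret orbit_setting n G L R
    using assms by (intro orbit_setting.intro relation_setting.intro orbit_setting_axioms.intro)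
  show ?thesis
    using subquotient_simple subquotient_gl_module tab_class_inj tab_class_basis by blast
qed

end
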